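(* Let $1<p\le 2$ and let $n,d\in\mathbb{N}$ be positive integers. For each $k=1,\dots,n$, let $f_k\in L^p(\mathbb{R}^d)$ be a nonzero function and let $\Gamma_k$ be an arbitrary sequence in $\mathbb{R}^d$. Then the disjoint union $\bigcup_{k=1}^n T_p(f_k,\Gamma_k)$ of the families $T_p(f_k,\Gamma_k)=\{T_\gamma f_k\}_{\gamma\in\Gamma_k}$ can at most be an unconditional basis for a proper subspace of $L^p(\mathbb{R}^d)$. Equivalently, there is no unconditional basis of $L^p(\mathbb{R}^d)$ of the form $\bigcup_{k=1}^n T_p(f_k,\Gamma_k)$.
   Context: Translation: for $\gamma\in\mathbb{R}^d$, $(T_\gamma f)(x)=f(x-\gamma)$. A sequence $\Gamma=\{\gamma_i\}_{i\in I}$ in $\mathbb{R}^d$ is a family indexed by a countable set $I$ (repetitions allowed), and $T_p(f,\Gamma)=\{T_{\gamma_i}f\}_{i\in I}$; disjoint unions are taken with respect to indices, i.e. with multiplicity. A sequence $\{x_n\}$ in a Banach space $X$ is an unconditional basis for $X$ if for every $x\in X$ there is a unique sequence of scalars $\{a_n\}$ with $x=\sum_{n=1}^\infty a_nx_n$ and the convergence is unconditional, i.e. $x=\sum_{n=1}^\infty a_{\pi(n)}x_{\pi(n)}$ for all permutations $\pi$ of $\mathbb{N}$. A countable family is called an unconditional basis if some (equivalently, every) enumeration of it is. *)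

theory Defs
  imports "HOL-Analysis.Analysis"
begin

text \<open>The scalar field is any type \<open>'k\<close> of the classes \<^class>\<open>real_normed_field\<close> and
  \<^class>\<open>euclidean_space\<close>; the instances \<^typ>\<open>real\<close> and \<^typ>\<open>complex\<close> give the real and the
  complex \<open>L\<^sup>p\<close> spaces. Elements of \<open>L\<^sup>p\<close> are represented by functions; equality in \<open>L\<^sup>p\<close> is
  equality almost everywhere.\<close>

definition Lp :: "real \<Rightarrow> ('v::euclidean_space \<Rightarrow> 'k::{real_normed_field, euclidean_space}) set" where
  "Lp p = {f. f \<in> borel_measurable lebesgue \<and> integrable lebesgue (\<lambda>t. norm (f t) powr p)}"

definition Lp_norm :: "real \<Rightarrow> ('v::euclidean_space \<Rightarrow> 'k::{real_normed_field, euclidean_space}) \<Rightarrow> real" where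
  "Lp_norm p f = (integral\<^sup>L lebesgue (\<lambda>t. norm (f t) powr p)) powr (1 / p)"

definition translate :: "'v \<Rightarrow> ('v \<Rightarrow> 'k) \<Rightarrow> ('v::euclidean_space \<Rightarrow> 'k)" where
  "translate \<gamma> f = (\<lambda>x. f (x - \<gamma>))"

definition Lp_sums ::
  "real \<Rightarrow> (nat \<Rightarrow> 'v::euclidean_space \<Rightarrow> 'k::{real_normed_field, euclidean_space})
     \<Rightarrow> (nat \<Rightarrow> 'k) \<Rightarrow> ('v \<Rightarrow> 'k) \<Rightarrow> bool" where
  "Lp_sums p xs a x \<longleftrightarrow> (\<lambda>N. Lp_norm p (\<lambda>t. x t - (\<Sum>m<N. a m * xs m t))) \<longlonglongrightarrow> 0"

definition unconditional_basis_seq ::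
  "real \<Rightarrow> (nat \<Rightarrow> 'v::euclidean_space \<Rightarrow> 'k::{real_normed_field, euclidean_space}) \<Rightarrow> bool" where
  "unconditional_basis_seq p xs \<longleftrightarrow>
     (\<forall>m. xs m \<in> Lp p) \<and>
     (\<forall>x\<in>Lp p. \<exists>a. Lp_sums p xs a x \<and> (\<forall>b. Lp_sums p xs b x \<longrightarrow> b = a) \<and>
        (\<forall>\<pi>. bij \<pi> \<longrightarrow> Lp_sums p (xs \<circ> \<pi>) (a \<circ> \<pi>) x))"

text \<open>An infinite family is a basis if some enumeration of it is. A finite family has no enumeration
  by \<open>\<nat>\<close>; for it, being a basis means being an algebraic basis modulo almost everywhere equality.\<close>

definition unconditional_basis ::
  "real \<Rightarrow> 'j set \<Rightarrow> ('j \<Rightarrow> 'v::euclidean_space \<Rightarrow> 'k::{real_normed_field, euclidean_space}) \<Rightarrow> bool" where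
  "unconditional_basis p J F \<longleftrightarrow>
     (if finite J then
        (\<forall>j\<in>J. F j \<in> Lp p) \<and>
        (\<forall>x\<in>Lp p. \<exists>a. (AE t in lebesgue. x t = (\<Sum>j\<in>J. a j * F j t)) \<and>
           (\<forall>b. (AE t in lebesgue. x t = (\<Sum>j\<in>J. b j * F j t)) \<longrightarrow> (\<forall>j\<in>J. b j = a j)))
      else \<exists>e::nat \<Rightarrow> 'j. bij_betw e UNIV J \<and> unconditional_basis_seq p (F \<circ> e))"

end

theory Submission imports Defs begin

text \<open>Suppose that the translates, enumerated as \<open>x\<^sub>0, x\<^sub>1, \<dots>\<close>, formed an unconditional basis, and write
\<open>c\<^sub>m\<close> for the coordinates. Two quantitative consequences of this contradict each other on small sets.

Unconditionality makes the coordinate projections onto finite sets of indices uniformly bounded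
(\<open>proj_bounded\<close>). Continuity of the coordinates is not part of the definition of a basis; it comes
from completeness through Zabreiko's lemma, in the form
\<open>Lp_countably_subadditive_seminorm_bounded\<close>, applied to the supremum of the norms of all finite
partial sums. That supremum is finite because otherwise disjoint blocks of terms of norm at least 1
could be arranged consecutively, and this rearrangement of the series would diverge.

Bounded projections keep distinct basis vectors apart in norm. Translation is continuous in \<open>L\<^sup>p\<close>, so
there is \<open>r > 0\<close> such that the centres of any two translates of the same \<open>f\<^sub>k\<close> are at distance at
least \<open>r\<close> (\<open>centres_separated\<close>). This has two effects.
  \<^item> Only a bounded amount \<open>L\<close> of the mass \<open>\<Sum>\<^sub>m \<integral> \<bar>x\<^sub>m\<bar>\<^sup>p\<close> falls into a ball \<open>Q\<close> of radius \<open>r/2\<close>, since the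
    preimages of \<open>Q\<close> under the translations of one class are disjoint (\<open>local_mass_bounded\<close>).
  \<^item> The coordinates satisfy \<open>\<Sum>\<^sub>m \<bar>c\<^sub>m\<bar>\<^sup>p \<le> B \<parallel>x\<parallel>\<^sup>p\<close> (\<open>lower_p_estimate\<close>): some ball of radius \<open>r/2\<close>
    carries mass of \<open>f\<^sub>k\<close>, its translates are disjoint, and for suitable signs the sum
    \<open>\<Sum>\<^sub>m \<plusminus> c\<^sub>m x\<^sub>m\<close> is at least as large on these balls as its individual terms
    (\<open>Lp_mass_signs\<close>), while its norm is controlled by the projections.

Now expand the indicator of a set \<open>E\<close> of positive measure inside \<open>Q\<close>. For \<open>p \<le> 2\<close> one has, pointwise,
\<open>\<bar>\<Sum>\<^sub>m c\<^sub>m x\<^sub>m(t)\<bar>\<^sup>p \<le> (\<Sum>\<^sub>m \<bar>c\<^sub>m\<bar>\<^sup>p) (\<Sum>\<^sub>m \<bar>x\<^sub>m(t)\<bar>\<^sup>p)\<close>, and here \<open>\<Sum>\<^sub>m \<bar>c\<^sub>m\<bar>\<^sup>p \<le> B \<bar>E\<bar>\<close>. Integrating over \<open>E\<close>,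
where the partial sums approach 1, the factor \<open>\<bar>E\<bar>\<close> cancels: the basis vectors have mass at least a
fixed \<open>\<beta> > 0\<close> on \<open>E\<close>, no matter how small \<open>E\<close> is (\<open>mass_on_every_set\<close>). More than \<open>L / \<beta>\<close> disjoint
sets in \<open>Q\<close> then carry more mass than \<open>L\<close>.\<close>

section \<open>The space \<open>L\<^sup>p\<close> and its norm\<close>

text \<open>For positive \<open>a\<close> and \<open>b\<close> this is convexity of the power function; at the boundary point 0 it reduces to
\<open>v\<^sup>p \<le> v\<close> for \<open>v\<close> between 0 and 1.\<close>

lemma powr_convex_combination:
  fixes a b u p :: real
  assumes "1 \<le> p" "0 \<le> a" "0 \<le> b" "0 \<le> u" "u \<le> 1"
  shows "(u * a + (1 - u) * b) powr p \<le> u * a powr p + (1 - u) * b powr p"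
proof -
  have scale: "(v * c) powr p \<le> v * c powr p" if "0 \<le> v" "v \<le> 1" for v c :: real
  proof (cases "v = 0")
    case False
    then have "v powr p \<le> v"
      using that assms by (intro powr_le_one_le) auto
    then show ?thesis
      by (simp add: powr_mult mult_right_mono)
  qed simp
  show ?thesis
  proof (cases "a = 0 \<or> b = 0")
    case True
    then show ?thesis
      using scale[of u a] scale[of "1 - u" b] assms by auto
  next
    case False
    then show ?thesis
      using convex_onD[OF powr_convex[OF \<open>1 \<le> p\<close>], of "1 - u" a b] assms by auto
  qed
qed

lemma powr_add_le_two_powr:
  fixes a b p :: real
  assumes "1 \<le> p" "0 \<le> a" "0 \<le> b"
  shows "(a + b) powr p \<le> 2 powr p * (a powr p + b powr p)"
proof -
  have "(a + b) powr p \<le> (2 * max a b) powr p"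
    using assms by (intro powr_mono2) auto
  also have "\<dots> = 2 powr p * max a b powr p"
    by (simp add: powr_mult)
  also have "\<dots> \<le> 2 powr p * (a powr p + b powr p)"
    by (intro mult_left_mono) (auto simp: max_def)
  finally show ?thesis .
qed

lemma Lp_measurable: "f \<in> Lp p \<Longrightarrow> f \<in> borel_measurable lebesgue"
  by (simp add: Lp_def)

lemma Lp_integrable: "f \<in> Lp p \<Longrightarrow> integrable lebesgue (\<lambda>t. norm (f t) powr p)"
  by (simp add: Lp_def)

lemma Lp_integrable_on:
  assumes "f \<in> Lp p" "S \<in> sets lebesgue"
  shows "integrable lebesgue (\<lambda>t. indicator S t * norm (f t) powr p)"
  using integrable_mult_indicator[OF assms(2) Lp_integrable[OF assms(1)]] by simp

lemma Lp_dominated: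
  assumes "1 \<le> p" "f \<in> borel_measurable lebesgue" "g \<in> Lp p" "\<And>t. norm (f t) \<le> norm (g t)"
  shows "f \<in> Lp p"
proof -
  have "integrable lebesgue (\<lambda>t. norm (f t) powr p)"
    by (rule Bochner_Integration.integrable_bound[OF Lp_integrable[OF assms(3)]])
      (use assms in \<open>auto intro!: powr_mono2\<close>)
  then show ?thesis using assms by (simp add: Lp_def)
qed

lemma Lp_zero [simp]: "(\<lambda>t. 0) \<in> Lp p"
  by (simp add: Lp_def)

lemma Lp_add:
  assumes "1 \<le> p" "f \<in> Lp p" "g \<in> Lp p"
  shows "(\<lambda>t. f t + g t) \<in> Lp p"
proof -
  note [measurable] = Lp_measurable[OF assms(2)] Lp_measurable[OF assms(3)]
  have "integrable lebesgue (\<lambda>t. 2 powr p * (norm (f t) powr p + norm (g t) powr p))"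
    using assms by (auto intro!: Lp_integrable)
  then have "integrable lebesgue (\<lambda>t. norm (f t + g t) powr p)"
  proof (rule Bochner_Integration.integrable_bound)
    show "AE t in lebesgue. norm (norm (f t + g t) powr p)
            \<le> norm (2 powr p * (norm (f t) powr p + norm (g t) powr p))"
    proof (rule AE_I2)
      fix t
      have "norm (f t + g t) powr p \<le> (norm (f t) + norm (g t)) powr p"
        using assms by (intro powr_mono2) (auto intro: norm_triangle_ineq)
      also have "\<dots> \<le> 2 powr p * (norm (f t) powr p + norm (g t) powr p)"
        using assms by (intro powr_add_le_two_powr) auto
      finally show "norm (norm (f t + g t) powr p)
            \<le> norm (2 powr p * (norm (f t) powr p + norm (g t) powr p))" by simp
    qed
  qed simp
  then show ?thesis by (simp add: Lp_def)
qed

lemma Lp_cmult: "f \<in> Lp p \<Longrightarrow> (\<lambda>t. a * f t) \<in> Lp p"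
  by (auto simp: Lp_def norm_mult powr_mult)

lemma Lp_scaleR: "f \<in> Lp p \<Longrightarrow> (\<lambda>t. r *\<^sub>R f t) \<in> Lp p"
  by (auto simp: Lp_def powr_mult)

lemma Lp_diff:
  assumes "1 \<le> p" "f \<in> Lp p" "g \<in> Lp p"
  shows "(\<lambda>t. f t - g t) \<in> Lp p"
  using Lp_add[OF assms(1,2) Lp_cmult[OF assms(3), of "-1"]] by simp

lemma Lp_sum:
  assumes "1 \<le> p" "\<And>i. i \<in> A \<Longrightarrow> f i \<in> Lp p"
  shows "(\<lambda>t. \<Sum>i\<in>A. f i t) \<in> Lp p"
  using assms(2)
proof (induction A rule: infinite_finite_induct)
  case (insert i A)
  then show ?case
    using Lp_add[OF assms(1), of "f i" "\<lambda>t. \<Sum>i\<in>A. f i t"] by simp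
qed simp_all

lemma Lp_restrict:
  assumes "1 \<le> p" "f \<in> Lp p" "S \<in> sets lebesgue"
  shows "(\<lambda>t. indicator S t * f t) \<in> Lp p"
proof (rule Lp_dominated[OF assms(1) _ assms(2)])
  note [measurable] = Lp_measurable[OF assms(2)] assms(3)
  show "(\<lambda>t. indicator S t * f t) \<in> borel_measurable lebesgue"
    by measurable
qed (auto simp: indicator_def)

lemma Lp_norm_nonneg [simp]: "0 \<le> Lp_norm p f"
  by (simp add: Lp_norm_def)

lemma Lp_norm_zero [simp]: "Lp_norm p (\<lambda>t. 0) = 0"
  by (simp add: Lp_norm_def)

lemma Lp_norm_powr:
  assumes "1 \<le> p"
  shows "Lp_norm p f powr p = (LINT t|lebesgue. norm (f t) powr p)"
  using assms by (simp add: Lp_norm_def powr_powr)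

lemma Lp_norm_le_iff:
  assumes "1 \<le> p" "0 \<le> c"
  shows "Lp_norm p f \<le> c \<longleftrightarrow> (LINT t|lebesgue. norm (f t) powr p) \<le> c powr p"
  unfolding Lp_norm_powr[OF assms(1), symmetric]
  using assms powr_mono2[of p "Lp_norm p f" c] powr_less_mono2[of p c "Lp_norm p f"]
  by fastforce

lemma Lp_norm_mono:
  assumes "1 \<le> p" "g \<in> Lp p" "\<And>t. norm (f t) \<le> norm (g t)"
  shows "Lp_norm p f \<le> Lp_norm p g"
proof -
  have "(LINT t|lebesgue. norm (f t) powr p) \<le> (LINT t|lebesgue. norm (g t) powr p)"
    using assms by (intro integral_mono' Lp_integrable) (auto intro!: powr_mono2)
  then show ?thesis
    using assms by (simp add: Lp_norm_le_iff Lp_norm_powr)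
qed

lemma Lp_norm_cmult:
  assumes "1 \<le> p"
  shows "Lp_norm p (\<lambda>t. a * f t) = norm a * Lp_norm p f"
  using assms by (simp add: Lp_norm_def norm_mult powr_mult powr_powr)

lemma Lp_norm_scaleR:
  assumes "1 \<le> p"
  shows "Lp_norm p (\<lambda>t. r *\<^sub>R f t) = \<bar>r\<bar> * Lp_norm p f"
  using assms by (simp add: Lp_norm_def powr_mult powr_powr)

lemma Lp_norm_diff_commute: "Lp_norm p (\<lambda>t. f t - g t) = Lp_norm p (\<lambda>t. g t - f t)"
  by (simp add: Lp_norm_def norm_minus_commute)

lemma Lp_norm_eq_0_iff:
  assumes "1 \<le> p" "f \<in> Lp p"
  shows "Lp_norm p f = 0 \<longleftrightarrow> (AE t in lebesgue. f t = 0)"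
  using assms integral_nonneg_eq_0_iff_AE[OF Lp_integrable[OF assms(2)]]
  by (simp add: Lp_norm_def)

text \<open>Minkowski's inequality. If \<open>\<alpha>\<close> and \<open>\<beta>\<close> bound the two norms, then \<open>\<bar>f + g\<bar> / (\<alpha> + \<beta>)\<close> is at most the
convex combination of \<open>\<bar>f\<bar> / \<alpha>\<close> and \<open>\<bar>g\<bar> / \<beta>\<close> with weights \<open>\<alpha> / (\<alpha> + \<beta>)\<close> and \<open>\<beta> / (\<alpha> + \<beta>)\<close>. Convexity
of the power function and integration give norm at most 1 for it.\<close>

lemma Lp_norm_triangle:
  assumes p: "1 \<le> p" and f: "f \<in> Lp p" and g: "g \<in> Lp p"
  shows "Lp_norm p (\<lambda>t. f t + g t) \<le> Lp_norm p f + Lp_norm p g"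
proof -
  define F where "F = Lp_norm p f"
  define G where "G = Lp_norm p g"
  \<comment> \<open>enlarging the norms by \<open>e\<close> makes them positive, so that one may divide by them\<close>
  have "Lp_norm p (\<lambda>t. f t + g t) \<le> (F + e) + (G + e)" if "0 < e" for e
  proof -
    define \<alpha> where "\<alpha> = F + e"
    define \<beta> where "\<beta> = G + e"
    have pos: "0 < \<alpha>" "0 < \<beta>" "F \<le> \<alpha>" "G \<le> \<beta>"
      using that by (auto simp: \<alpha>_def \<beta>_def F_def G_def intro: add_nonneg_pos)
    define u where "u = \<alpha> / (\<alpha> + \<beta>)"
    have u: "0 \<le> u" "u \<le> 1" "1 - u = \<beta> / (\<alpha> + \<beta>)"
      using pos by (auto simp: u_def divide_simps)
    define K where "K = (\<alpha> + \<beta>) powr p"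
    have bound: "norm (f t + g t) powr p
        \<le> K * u / \<alpha> powr p * norm (f t) powr p + K * (1 - u) / \<beta> powr p * norm (g t) powr p" for t
    proof -
      have "norm (f t + g t) \<le> norm (f t) + norm (g t)"
        by (rule norm_triangle_ineq)
      also have "\<dots> = (\<alpha> + \<beta>) * (u * (norm (f t) / \<alpha>) + (1 - u) * (norm (g t) / \<beta>))"
      proof -
        have "(\<alpha> + \<beta>) * (u * (x / \<alpha>)) = x" "(\<alpha> + \<beta>) * ((1 - u) * (x / \<beta>)) = x" for x
          unfolding u(3) using pos by (auto simp: u_def)
        then show ?thesis
          by (simp add: distrib_left)
      qed
      finally have "norm (f t + g t) powr p
          \<le> ((\<alpha> + \<beta>) * (u * (norm (f t) / \<alpha>) + (1 - u) * (norm (g t) / \<beta>))) powr p"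
        using p by (intro powr_mono2) auto
      also have "\<dots> = K * (u * (norm (f t) / \<alpha>) + (1 - u) * (norm (g t) / \<beta>)) powr p"
        by (simp add: powr_mult K_def)
      also have "\<dots> \<le> K * (u * (norm (f t) / \<alpha>) powr p + (1 - u) * (norm (g t) / \<beta>) powr p)"
        using p u pos by (intro mult_left_mono powr_convex_combination) (auto simp: K_def)
      also have "\<dots> = K * u / \<alpha> powr p * norm (f t) powr p + K * (1 - u) / \<beta> powr p * norm (g t) powr p"
        by (simp add: powr_divide algebra_simps)
      finally show ?thesis .
    qed
    have int: "(LINT t|lebesgue. norm (f t) powr p) \<le> \<alpha> powr p"
              "(LINT t|lebesgue. norm (g t) powr p) \<le> \<beta> powr p"
      using pos p by (auto simp: F_def G_def Lp_norm_le_iff)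
    have "(LINT t|lebesgue. norm (f t + g t) powr p)
       \<le> (LINT t|lebesgue. K * u / \<alpha> powr p * norm (f t) powr p + K * (1 - u) / \<beta> powr p * norm (g t) powr p)"
      by (intro integral_mono Lp_integrable Lp_add Bochner_Integration.integrable_add
          Bochner_Integration.integrable_mult_right p f g bound)
    also have "\<dots> = K * u / \<alpha> powr p * (LINT t|lebesgue. norm (f t) powr p)
        + K * (1 - u) / \<beta> powr p * (LINT t|lebesgue. norm (g t) powr p)"
      using Lp_integrable[OF f] Lp_integrable[OF g] by simp
    also have "\<dots> \<le> K * u / \<alpha> powr p * \<alpha> powr p + K * (1 - u) / \<beta> powr p * \<beta> powr p"
      using int u pos by (intro add_mono mult_left_mono) (auto simp: K_def)
    also have "\<dots> = K * u + K * (1 - u)"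
      using pos by simp
    also have "\<dots> = K"
      by (simp add: algebra_simps)
    finally show ?thesis
      using p pos by (simp add: Lp_norm_le_iff K_def \<alpha>_def \<beta>_def)
  qed
  from this[of "e / 2" for e] have "Lp_norm p (\<lambda>t. f t + g t) \<le> (F + G) + e" if "0 < e" for e
    using that by (fastforce simp: algebra_simps)
  then show ?thesis
    by (metis F_def G_def field_le_epsilon)
qed

lemma Lp_norm_triangle_diff:
  assumes "1 \<le> p" "f \<in> Lp p" "g \<in> Lp p"
  shows "Lp_norm p (\<lambda>t. f t - g t) \<le> Lp_norm p f + Lp_norm p g"
  using Lp_norm_triangle[OF assms(1,2) Lp_cmult[OF assms(3), of "-1"]] Lp_norm_cmult[OF assms(1), of "-1" g]
  by simp

lemma Lp_norm_triangle3:
  assumes "1 \<le> p" "f \<in> Lp p" "g \<in> Lp p" "h \<in> Lp p"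
  shows "Lp_norm p (\<lambda>t. f t - h t) \<le> Lp_norm p (\<lambda>t. f t - g t) + Lp_norm p (\<lambda>t. g t - h t)"
  using Lp_norm_triangle[OF assms(1), of "\<lambda>t. f t - g t" "\<lambda>t. g t - h t"] Lp_diff assms by fastforce

lemma Lp_norm_sum_le:
  assumes "1 \<le> p" "\<And>i. i \<in> A \<Longrightarrow> f i \<in> Lp p"
  shows "Lp_norm p (\<lambda>t. \<Sum>i\<in>A. f i t) \<le> (\<Sum>i\<in>A. Lp_norm p (f i))"
  using assms(2)
proof (induction A rule: infinite_finite_induct)
  case (insert i A)
  then show ?case
    using Lp_norm_triangle[OF assms(1), of "f i" "\<lambda>t. \<Sum>i\<in>A. f i t"] Lp_sum[OF assms(1), of A f]
    by fastforce
qed simp_all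

lemma Lp_indicator:
  assumes "1 \<le> p" "S \<in> lmeasurable"
  shows "(indicator S :: 'v::euclidean_space \<Rightarrow> 'k::{real_normed_field, euclidean_space}) \<in> Lp p"
    and "Lp_norm p (indicator S :: 'v \<Rightarrow> 'k) = measure lebesgue S powr (1 / p)"
proof -
  have eq: "norm (indicator S t :: 'k) powr p = indicator S t" for t
    by (simp add: indicator_def)
  show "(indicator S :: 'v \<Rightarrow> 'k) \<in> Lp p"
    using assms by (auto simp: Lp_def eq fmeasurable_def)
  show "Lp_norm p (indicator S :: 'v \<Rightarrow> 'k) = measure lebesgue S powr (1 / p)"
    using assms by (simp add: Lp_norm_def eq)
qed

section \<open>Completeness\<close>

lemma nn_integral_Lp:
  assumes "f \<in> Lp p"
  shows "(\<integral>\<^sup>+ t. ennreal (norm (f t) powr p) \<partial>lebesgue) = ennreal (LINT t|lebesgue. norm (f t) powr p)"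
  using Lp_integrable[OF assms] by (intro nn_integral_eq_integral) auto

lemma Lp_geometric_Cauchy:
  fixes z :: "nat \<Rightarrow> 'v::euclidean_space \<Rightarrow> 'k::{real_normed_field, euclidean_space}"
  assumes p: "1 \<le> p" and z: "\<And>m. z m \<in> Lp p"
    and step: "\<And>m. Lp_norm p (\<lambda>t. z (Suc m) t - z m t) \<le> e * (1/2) ^ m"
    and "m \<le> k"
  shows "Lp_norm p (\<lambda>t. z k t - z m t) \<le> 2 * e * (1/2) ^ m"
proof -
  have e: "0 \<le> e"
    using order_trans[OF Lp_norm_nonneg step[of 0]] by simp
  have "Lp_norm p (\<lambda>t. z (m + i) t - z m t) \<le> 2 * e * (1/2) ^ m - 2 * e * (1/2) ^ (m + i)" for i
  proof (induction i)
    case (Suc i)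
    have "Lp_norm p (\<lambda>t. z (m + Suc i) t - z m t)
        \<le> Lp_norm p (\<lambda>t. z (m + Suc i) t - z (m + i) t) + Lp_norm p (\<lambda>t. z (m + i) t - z m t)"
      by (intro Lp_norm_triangle3 p z)
    then show ?case
      using Suc step[of "m + i"] by simp
  qed simp
  from this[of "k - m"] have "Lp_norm p (\<lambda>t. z k t - z m t) \<le> 2 * e * (1/2) ^ m - 2 * e * (1/2) ^ k"
    using \<open>m \<le> k\<close> by simp
  also have "\<dots> \<le> 2 * e * (1/2) ^ m"
    using e by simp
  finally show ?thesis .
qed

text \<open>Riesz-Fischer, for sequences with geometrically decreasing steps. The sum of the absolute values of
the steps has finite \<open>p\<close>-th moment by monotone convergence, so the sequence converges almost
everywhere; Fatou's lemma turns the pointwise limit into a norm limit with the stated rate.\<close>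

lemma Lp_complete:
  fixes z :: "nat \<Rightarrow> 'v::euclidean_space \<Rightarrow> 'k::{real_normed_field, euclidean_space}"
  assumes p: "1 \<le> p" and z: "\<And>m. z m \<in> Lp p"
    and step: "\<And>m. Lp_norm p (\<lambda>t. z (Suc m) t - z m t) \<le> e * (1/2) ^ m"
  obtains x where "x \<in> Lp p" "\<And>m. Lp_norm p (\<lambda>t. x t - z m t) \<le> 2 * e * (1/2) ^ m"
proof -
  have e: "0 \<le> e"
    using order_trans[OF Lp_norm_nonneg step[of 0]] by simp
  note [measurable] = Lp_measurable[OF z]
  define h where "h n t = norm (z (Suc n) t - z n t)" for n t
  define G where "G M t = (\<Sum>n<M. h n t)" for M t
  have [measurable]: "h n \<in> borel_measurable lebesgue" for n
    unfolding h_def by measurable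
  have h: "h n \<in> Lp p" "Lp_norm p (h n) = Lp_norm p (\<lambda>t. z (Suc n) t - z n t)" for n
    using Lp_diff[OF p z z, of "Suc n" n] by (auto simp: h_def Lp_def Lp_norm_def)
  have G: "G M \<in> Lp p" for M
    unfolding G_def using Lp_sum[OF p, of "{..<M}" h] h by simp
  have h_nonneg: "0 \<le> h n t" for n t
    by (simp add: h_def)
  have G_norm: "Lp_norm p (G M) \<le> 2 * e" for M
  proof -
    have "Lp_norm p (G M) \<le> (\<Sum>n<M. Lp_norm p (h n))"
      unfolding G_def by (intro Lp_norm_sum_le p h)
    also have "\<dots> \<le> (\<Sum>n<M. e * (1/2) ^ n)"
      unfolding h by (intro sum_mono step)
    also have "\<dots> = e * (\<Sum>n<M. (1/2) ^ n)"
      by (simp add: sum_distrib_left)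
    also have "\<dots> \<le> e * 2"
      using e by (intro mult_left_mono) (auto simp: sum_gp_strict)
    finally show ?thesis by simp
  qed
  have "(\<integral>\<^sup>+ t. (SUP M. ennreal (norm (G M t) powr p)) \<partial>lebesgue)
      = (SUP M. \<integral>\<^sup>+ t. ennreal (norm (G M t) powr p) \<partial>lebesgue)"
  proof (rule nn_integral_monotone_convergence_SUP)
    show "incseq (\<lambda>M t. ennreal (norm (G M t) powr p))"
    proof (intro incseq_SucI le_funI ennreal_leI powr_mono2)
      show "norm (G M t) \<le> norm (G (Suc M) t)" for M t
        using h_nonneg by (simp add: G_def sum_nonneg)
    qed (use p in auto)
  qed (use Lp_measurable[OF G] in measurable)
  also have "\<dots> \<le> ennreal ((2 * e) powr p)"
  proof (rule SUP_least)
    show "(\<integral>\<^sup>+ t. ennreal (norm (G M t) powr p) \<partial>lebesgue) \<le> ennreal ((2 * e) powr p)" for M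
      unfolding nn_integral_Lp[OF G] using G_norm[of M] e p by (intro ennreal_leI) (simp add: Lp_norm_le_iff)
  qed
  finally have "(\<integral>\<^sup>+ t. (SUP M. ennreal (norm (G M t) powr p)) \<partial>lebesgue) \<noteq> \<infinity>"
    by (auto simp: top_unique)
  then have "AE t in lebesgue. (SUP M. ennreal (norm (G M t) powr p)) \<noteq> \<infinity>"
    using Lp_measurable[OF G] by (intro nn_integral_PInf_AE) measurable
  then have conv: "AE t in lebesgue. convergent (\<lambda>m. z m t)"
  proof eventually_elim
    case (elim t)
    then obtain C where C: "(SUP M. ennreal (norm (G M t) powr p)) = ennreal C" "0 \<le> C"
      by (metis ennreal_cases infinity_ennreal_def)
    have "G M t \<le> C powr (1/p)" for M
    proof -
      have "ennreal (norm (G M t) powr p) \<le> ennreal C"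
        unfolding C(1)[symmetric] by (rule SUP_upper) simp
      then have "norm (G M t) powr p \<le> C"
        using C by simp
      then have "(norm (G M t) powr p) powr (1/p) \<le> C powr (1/p)"
        using p by (intro powr_mono2) auto
      then show ?thesis
        using p by (simp add: powr_powr)
    qed
    then have "summable (\<lambda>n. h n t)"
      using h_nonneg by (intro summableI_nonneg_bounded[where x = "C powr (1/p)"]) (auto simp: G_def)
    then have "summable (\<lambda>n. z (Suc n) t - z n t)"
      unfolding h_def by (rule summable_norm_cancel)
    then have "convergent (\<lambda>m. (\<Sum>n<m. z (Suc n) t - z n t) + z 0 t)"
      by (intro convergent_add convergent_const) (simp add: summable_iff_convergent)
    then show ?case
      unfolding sum_lessThan_telescope[of "\<lambda>n. z n t"] by simp
  qed
  define x where "x t = lim (\<lambda>m. z m t)" for t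
  have [measurable]: "x \<in> borel_measurable lebesgue"
    unfolding x_def by measurable
  have lim: "AE t in lebesgue. (\<lambda>m. z m t) \<longlonglongrightarrow> x t"
    using conv by eventually_elim (simp add: x_def convergent_LIMSEQ_iff)
  have fatou: "(\<integral>\<^sup>+ t. ennreal (norm (x t - z m t) powr p) \<partial>lebesgue) \<le> ennreal ((2 * e * (1/2) ^ m) powr p)" for m
  proof -
    have "(\<integral>\<^sup>+ t. ennreal (norm (x t - z m t) powr p) \<partial>lebesgue)
        = (\<integral>\<^sup>+ t. liminf (\<lambda>k. ennreal (norm (z k t - z m t) powr p)) \<partial>lebesgue)"
    proof (rule nn_integral_cong_AE)
      show "AE t in lebesgue. ennreal (norm (x t - z m t) powr p)
          = liminf (\<lambda>k. ennreal (norm (z k t - z m t) powr p))"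
        using lim
      proof eventually_elim
        case (elim t)
        have "(\<lambda>k. ennreal (norm (z k t - z m t) powr p)) \<longlonglongrightarrow> ennreal (norm (x t - z m t) powr p)"
          using elim p by (intro tendsto_ennrealI tendsto_powr' tendsto_norm tendsto_diff tendsto_const) auto
        from lim_imp_Liminf[OF trivial_limit_sequentially this] show ?case
          by simp
      qed
    qed
    also have "\<dots> \<le> liminf (\<lambda>k. \<integral>\<^sup>+ t. ennreal (norm (z k t - z m t) powr p) \<partial>lebesgue)"
      by (intro nn_integral_liminf) measurable
    also have "\<dots> \<le> ennreal ((2 * e * (1/2) ^ m) powr p)"
    proof -
      have "eventually (\<lambda>k. (\<integral>\<^sup>+ t. ennreal (norm (z k t - z m t) powr p) \<partial>lebesgue)
              \<le> ennreal ((2 * e * (1/2) ^ m) powr p)) sequentially"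
        using eventually_ge_at_top[of m]
      proof eventually_elim
        case (elim k)
        have "Lp_norm p (\<lambda>t. z k t - z m t) \<le> 2 * e * (1/2) ^ m"
          by (rule Lp_geometric_Cauchy[OF p z step elim])
        then show ?case
          using e p by (simp add: nn_integral_Lp[OF Lp_diff[OF p z z]] ennreal_leI Lp_norm_le_iff)
      qed
      then show ?thesis
        by (rule order_trans[OF Liminf_le_Limsup[OF trivial_limit_sequentially] Limsup_bounded])
    qed
    finally show ?thesis .
  qed
  have diff: "(\<lambda>t. x t - z m t) \<in> Lp p" for m
  proof -
    have "(\<integral>\<^sup>+ t. ennreal (norm (norm (x t - z m t) powr p)) \<partial>lebesgue) < \<infinity>"
      using le_less_trans[OF fatou[of m]] by simp
    then show ?thesis
      unfolding Lp_def by (auto intro!: integrableI_bounded)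
  qed
  have "x \<in> Lp p"
    using Lp_add[OF p diff[of 0] z[of 0]] by simp
  moreover have "Lp_norm p (\<lambda>t. x t - z m t) \<le> 2 * e * (1/2) ^ m" for m
    using fatou[of m] e p by (simp add: nn_integral_Lp[OF diff] Lp_norm_le_iff)
  ultimately show thesis
    by (rule that)
qed

section \<open>Translations\<close>

lemma measurable_translate_lebesgue [measurable]:
  "(\<lambda>x::'v::euclidean_space. x - \<gamma>) \<in> lebesgue \<rightarrow>\<^sub>M lebesgue"
  and distr_translate_lebesgue: "distr lebesgue lebesgue (\<lambda>x::'v. x - \<gamma>) = lebesgue"
proof -
  have eq: "(\<lambda>x::'v. - \<gamma> + (\<Sum>j\<in>Basis. (1 * (x \<bullet> j)) *\<^sub>R j)) = (\<lambda>x. x - \<gamma>)"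
    by (auto simp: euclidean_representation)
  show "(\<lambda>x::'v. x - \<gamma>) \<in> lebesgue \<rightarrow>\<^sub>M lebesgue"
    using lebesgue_affine_measurable[of "\<lambda>_. 1" "- \<gamma>"] unfolding eq by simp
  show "distr lebesgue lebesgue (\<lambda>x::'v. x - \<gamma>) = lebesgue"
    using lebesgue_affine_euclidean[of "\<lambda>_. 1" "- \<gamma>"] unfolding eq by (simp add: density_1)
qed

lemma integral_lebesgue_translate:
  fixes g :: "'v::euclidean_space \<Rightarrow> real"
  assumes "g \<in> borel_measurable lebesgue"
  shows "(LINT t|lebesgue. g (t - \<gamma>)) = (LINT t|lebesgue. g t)"
  using integral_distr[OF measurable_translate_lebesgue assms, of \<gamma>]
  by (simp add: distr_translate_lebesgue)

lemma translate_Lp: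
  assumes "f \<in> Lp p"
  shows "translate \<gamma> f \<in> Lp p"
proof -
  have "translate \<gamma> f \<in> borel_measurable lebesgue"
    unfolding translate_def
    using measurable_compose[OF measurable_translate_lebesgue Lp_measurable[OF assms]] .
  moreover have "integrable lebesgue (\<lambda>t. norm (f (t - \<gamma>)) powr p)"
    using integrable_distr[OF measurable_translate_lebesgue, of \<gamma> "\<lambda>t. norm (f t) powr p"]
      Lp_integrable[OF assms] by (simp add: distr_translate_lebesgue)
  ultimately show ?thesis
    by (simp add: Lp_def translate_def)
qed

lemma Lp_norm_translate:
  assumes "f \<in> Lp p"
  shows "Lp_norm p (translate \<gamma> f) = Lp_norm p f"
proof -
  note [measurable] = Lp_measurable[OF assms]
  have "(\<lambda>t. norm (f t) powr p) \<in> borel_measurable lebesgue"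
    by measurable
  from integral_lebesgue_translate[OF this] show ?thesis
    by (simp add: Lp_norm_def translate_def)
qed

text \<open>Continuity at 0 of the orbit map \<open>h \<mapsto> T\<^sub>h f\<close>. It holds for every function in \<open>L\<^sup>p\<close>
(\<open>translation_continuous_Lp\<close>), but passes through indicators and simple functions on the way.\<close>

definition translation_continuous where
  "translation_continuous p f \<longleftrightarrow> ((\<lambda>h. Lp_norm p (\<lambda>t. translate h f t - f t)) \<longlongrightarrow> 0) (nhds 0)"

text \<open>Squeeze \<open>S\<close> between a compact set \<open>K\<close> and an open set \<open>T\<close> of nearly the same measure. For small \<open>h\<close> the
shift by \<open>h\<close> or \<open>-h\<close> keeps \<open>K\<close> inside \<open>T\<close>, so \<open>S\<close> and \<open>S + h\<close> differ only within \<open>S - K\<close>, \<open>T - S\<close> and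
their shifts.\<close>

lemma translation_continuous_indicator:
  fixes S :: "'v::euclidean_space set"
  assumes p: "1 \<le> p" and S: "bounded S" "S \<in> sets lebesgue"
  shows "translation_continuous p (indicator S :: 'v \<Rightarrow> 'k::{real_normed_field, euclidean_space})"
  unfolding translation_continuous_def
proof (rule tendstoI)
  fix e :: real assume "0 < e"
  define \<eta> where "\<eta> = (e/2) powr p / 4"
  have "0 < \<eta>" using \<open>0 < e\<close> by (simp add: \<eta>_def)
  have Sm: "S \<in> lmeasurable"
    using S bounded_set_imp_lmeasurable by blast
  obtain T where T: "open T" "S \<subseteq> T" "T - S \<in> lmeasurable" "emeasure lebesgue (T - S) < ennreal \<eta>"
    using sets_lebesgue_outer_open[OF S(2) \<open>0 < \<eta>\<close>] by metis
  obtain K where K: "closed K" "K \<subseteq> S" "S - K \<in> lmeasurable" "emeasure lebesgue (S - K) < ennreal \<eta>"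
    using sets_lebesgue_inner_closed[OF S(2) \<open>0 < \<eta>\<close>] by metis
  have small: "measure lebesgue (T - S) \<le> \<eta>" "measure lebesgue (S - K) \<le> \<eta>"
    using T(3,4) K(3,4) \<open>0 < \<eta>\<close> by (auto simp: emeasure_eq_measure2 ennreal_less_iff)
  have "compact K"
    using K S bounded_subset compact_eq_bounded_closed by blast
  then obtain d where d: "0 < d" "(\<Union>x\<in>K. ball x d) \<subseteq> T"
    using compact_subset_open_imp_ball_epsilon_subset[of K T] T K by blast
  have "dist (Lp_norm p (\<lambda>t. translate h (indicator S) t - (indicator S t :: 'k))) 0 < e" if h: "norm h < d" for h
  proof -
    define W where "W = ((+) h ` (S - K) \<union> (T - S)) \<union> ((S - K) \<union> (+) h ` (T - S))"
    have W: "W \<in> lmeasurable"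
      unfolding W_def by (intro fmeasurable.Un measurable_translation T K)
    have "measure lebesgue W \<le> (\<eta> + \<eta>) + (\<eta> + \<eta>)"
      unfolding W_def
      by (intro order_trans[OF measure_Un_le] add_mono)
        (use small T(3) K(3) measurable_translation[of "S - K" h] measurable_translation[of "T - S" h] in
          \<open>auto simp: measure_translation fmeasurableD\<close>)
    then have mW: "measure lebesgue W \<le> (e/2) powr p"
      by (simp add: \<eta>_def)
    have pt: "norm (translate h (indicator S) t - (indicator S t :: 'k)) \<le> norm (indicator W t :: 'k)" for t
    proof (cases "t - h \<in> S \<longleftrightarrow> t \<in> S")
      case True
      then show ?thesis by (simp add: translate_def indicator_def)
    next
      case False
      have "t - h \<in> T" if "t \<in> K"
      proof -
        have "t - h \<in> ball t d" using h by (simp add: dist_norm)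
        then show ?thesis using d that by blast
      qed
      moreover have "t \<in> T" if "t - h \<in> K"
      proof -
        have "t \<in> ball (t - h) d" using h by (simp add: dist_norm)
        then show ?thesis using d that by blast
      qed
      moreover have "t \<in> (+) h ` A \<longleftrightarrow> t - h \<in> A" for A
        by (force simp: image_iff)
      ultimately have "t \<in> W"
        using False by (auto simp: W_def)
      then show ?thesis by (auto simp: translate_def indicator_def)
    qed
    have "Lp_norm p (\<lambda>t. translate h (indicator S) t - (indicator S t :: 'k)) \<le> Lp_norm p (indicator W :: 'v \<Rightarrow> 'k)"
      by (intro Lp_norm_mono p Lp_indicator W pt)
    also have "\<dots> = measure lebesgue W powr (1/p)"
      by (intro Lp_indicator p W)
    also have "\<dots> \<le> ((e/2) powr p) powr (1/p)"
      using p mW by (intro powr_mono2) auto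
    also have "\<dots> = e/2"
      using p \<open>0 < e\<close> by (simp add: powr_powr)
    finally show ?thesis
      using \<open>0 < e\<close> by simp
  qed
  then show "\<forall>\<^sub>F h in nhds 0. dist (Lp_norm p (\<lambda>t. translate h (indicator S) t - (indicator S t :: 'k))) 0 < e"
    using d(1) by (auto simp: eventually_nhds_metric dist_norm)
qed

lemma translation_continuous_cmult:
  assumes "1 \<le> p" "translation_continuous p f"
  shows "translation_continuous p (\<lambda>t. a * f t)"
proof -
  have "((\<lambda>h. norm a * Lp_norm p (\<lambda>t. translate h f t - f t)) \<longlongrightarrow> norm a * 0) (nhds 0)"
    using assms(2) unfolding translation_continuous_def by (intro tendsto_intros)
  then show ?thesis
    by (simp add: translation_continuous_def translate_def flip: Lp_norm_cmult[OF assms(1)] right_diff_distrib)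
qed

lemma translation_continuous_sum:
  assumes p: "1 \<le> p" and f: "\<And>i. i \<in> A \<Longrightarrow> f i \<in> Lp p" "\<And>i. i \<in> A \<Longrightarrow> translation_continuous p (f i)"
  shows "translation_continuous p (\<lambda>t. \<Sum>i\<in>A. f i t)"
  unfolding translation_continuous_def
proof (rule tendsto_sandwich[OF _ _ tendsto_const])
  show "((\<lambda>h. \<Sum>i\<in>A. Lp_norm p (\<lambda>t. translate h (f i) t - f i t)) \<longlongrightarrow> 0) (nhds 0)"
    using tendsto_sum[of A "\<lambda>i h. Lp_norm p (\<lambda>t. translate h (f i) t - f i t)" "\<lambda>_. 0"] f(2)
    by (simp add: translation_continuous_def)
  show "\<forall>\<^sub>F h in nhds 0. Lp_norm p (\<lambda>t. translate h (\<lambda>t. \<Sum>i\<in>A. f i t) t - (\<Sum>i\<in>A. f i t))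
      \<le> (\<Sum>i\<in>A. Lp_norm p (\<lambda>t. translate h (f i) t - f i t))"
  proof (rule always_eventually, rule allI)
    fix h
    have "Lp_norm p (\<lambda>t. \<Sum>i\<in>A. translate h (f i) t - f i t)
      \<le> (\<Sum>i\<in>A. Lp_norm p (\<lambda>t. translate h (f i) t - f i t))"
      by (intro Lp_norm_sum_le p Lp_diff translate_Lp f)
    then show "Lp_norm p (\<lambda>t. translate h (\<lambda>t. \<Sum>i\<in>A. f i t) t - (\<Sum>i\<in>A. f i t))
      \<le> (\<Sum>i\<in>A. Lp_norm p (\<lambda>t. translate h (f i) t - f i t))"
      by (simp add: translate_def sum_subtractf)
  qed
qed simp

lemma translation_continuous_simple:
  fixes s :: "'v::euclidean_space \<Rightarrow> 'k::{real_normed_field, euclidean_space}"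
  assumes p: "1 \<le> p" and s: "simple_function lebesgue s" and R: "\<And>t. R < norm t \<Longrightarrow> s t = 0"
  shows "translation_continuous p s"
proof -
  define S where "S y = s -` {y}" for y
  have S: "bounded (S y)" "S y \<in> sets lebesgue" if "y \<noteq> 0" for y
  proof -
    show "bounded (S y)"
      unfolding S_def bounded_iff using R that by (intro exI[of _ R]) force
    show "S y \<in> sets lebesgue"
      using simple_functionD(2)[OF s, of "{y}"] by (simp add: S_def)
  qed
  have fin: "finite (range s - {0})"
    using simple_functionD(1)[OF s] by simp
  have eq: "s = (\<lambda>t. \<Sum>y\<in>range s - {0}. y * indicator (S y) t)"
  proof
    fix t
    show "s t = (\<Sum>y\<in>range s - {0}. y * indicator (S y) t)"
    proof (cases "s t = 0")
      case True
      have "(\<Sum>y\<in>range s - {0}. y * indicator (S y) t) = 0"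
        using True by (intro sum.neutral) (auto simp: S_def indicator_def)
      then show ?thesis using True by simp
    next
      case False
      then have "(\<Sum>y\<in>range s - {0}. y * indicator (S y) t) = (\<Sum>y\<in>{s t}. y * indicator (S y) t)"
        using fin by (intro sum.mono_neutral_right) (auto simp: S_def indicator_def)
      then show ?thesis by (simp add: S_def)
    qed
  qed
  have "translation_continuous p (\<lambda>t. \<Sum>y\<in>range s - {0}. y * indicator (S y) t)"
    by (intro translation_continuous_sum translation_continuous_cmult translation_continuous_indicator
        Lp_cmult Lp_indicator bounded_set_imp_lmeasurable p S) auto
  then show ?thesis
    using eq by simp
qed

lemma translation_continuous_approx:
  assumes p: "1 \<le> p" and f: "f \<in> Lp p"
    and approx: "\<And>e. 0 < e \<Longrightarrow> \<exists>g\<in>Lp p. translation_continuous p g \<and> Lp_norm p (\<lambda>t. f t - g t) < e"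
  shows "translation_continuous p f"
  unfolding translation_continuous_def
proof (rule tendstoI)
  fix e :: real assume "0 < e"
  then obtain g where g: "g \<in> Lp p" "translation_continuous p g" "Lp_norm p (\<lambda>t. f t - g t) < e / 3"
    using approx[of "e / 3"] by auto
  have "\<forall>\<^sub>F h in nhds 0. dist (Lp_norm p (\<lambda>t. translate h g t - g t)) 0 < e / 3"
    using g(2) \<open>0 < e\<close> unfolding translation_continuous_def by (intro tendstoD) auto
  then show "\<forall>\<^sub>F h in nhds 0. dist (Lp_norm p (\<lambda>t. translate h f t - f t)) 0 < e"
  proof eventually_elim
    case (elim h)
    have "Lp_norm p (\<lambda>t. translate h f t - f t)
      \<le> Lp_norm p (\<lambda>t. translate h f t - translate h g t) + Lp_norm p (\<lambda>t. translate h g t - f t)"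
      by (intro Lp_norm_triangle3 p translate_Lp f g)
    also have "Lp_norm p (\<lambda>t. translate h g t - f t)
      \<le> Lp_norm p (\<lambda>t. translate h g t - g t) + Lp_norm p (\<lambda>t. g t - f t)"
      by (intro Lp_norm_triangle3 p translate_Lp f g)
    also have "Lp_norm p (\<lambda>t. translate h f t - translate h g t) = Lp_norm p (\<lambda>t. f t - g t)"
      using Lp_norm_translate[OF Lp_diff[OF p f g(1)], of h] by (simp add: translate_def)
    finally show ?case
      using elim g(3) Lp_norm_diff_commute[of p f g] by simp
  qed
qed

text \<open>Simple functions cut off to large balls approximate in norm, by dominated convergence; the cut-off
makes all their nonzero level sets bounded.\<close>

lemma translation_continuous_Lp:
  fixes f :: "'v::euclidean_space \<Rightarrow> 'k::{real_normed_field, euclidean_space}"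
  assumes p: "1 \<le> p" and f: "f \<in> Lp p"
  shows "translation_continuous p f"
proof (rule translation_continuous_approx[OF p f])
  fix e :: real assume "0 < e"
  note [measurable] = Lp_measurable[OF f]
  obtain s where s: "\<And>i. simple_function lebesgue (s i)"
    "\<And>t. (\<lambda>i. s i t) \<longlonglongrightarrow> f t" "\<And>i t. norm (s i t) \<le> 2 * norm (f t)"
    using borel_measurable_implies_sequence_metric[OF Lp_measurable[OF f], of 0] by auto
  define g where "g i t = indicator (cball 0 (real i)) t * s i t" for i t
  have g_simple: "simple_function lebesgue (g i)" for i
    unfolding g_def using s(1)[of i] by (intro simple_function_mult simple_function_indicator) auto
  have g_bound: "norm (g i t) \<le> 2 * norm (f t)" for i t
    using s(3)[of i t] by (auto simp: g_def indicator_def)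
  have g_meas [measurable]: "g i \<in> borel_measurable lebesgue" for i
    using g_simple by (rule borel_measurable_simple_function)
  have g: "g i \<in> Lp p" for i
    by (rule Lp_dominated[OF p _ Lp_scaleR[OF f, of 2]]) (use g_bound in auto)
  have g_lim: "(\<lambda>i. g i t) \<longlonglongrightarrow> f t" for t
  proof -
    have "eventually (\<lambda>i. g i t = s i t) sequentially"
      using eventually_ge_at_top[of "nat \<lceil>norm t\<rceil>"]
      by eventually_elim (auto simp: g_def indicator_def nat_ceiling_le_eq)
    then show ?thesis
      using s(2)[of t] by (simp add: tendsto_cong)
  qed
  have "(\<lambda>i. LINT t|lebesgue. norm (f t - g i t) powr p) \<longlonglongrightarrow> (LINT (t::'v)|lebesgue. 0)"
  proof (rule integral_dominated_convergence[where w = "\<lambda>t. (3 * norm (f t)) powr p"])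
    show "integrable lebesgue (\<lambda>t. (3 * norm (f t)) powr p)"
      using Lp_integrable[OF f] by (simp add: powr_mult)
    show "AE t in lebesgue. (\<lambda>i. norm (f t - g i t) powr p) \<longlonglongrightarrow> 0"
    proof (rule AE_I2)
      fix t
      have "(\<lambda>i. norm (f t - g i t) powr p) \<longlonglongrightarrow> norm (f t - f t) powr p"
        using g_lim p by (intro tendsto_powr' tendsto_intros) auto
      then show "(\<lambda>i. norm (f t - g i t) powr p) \<longlonglongrightarrow> 0" by simp
    qed
    show "AE t in lebesgue. norm (norm (f t - g i t) powr p) \<le> (3 * norm (f t)) powr p" for i
    proof (rule AE_I2)
      fix t
      have "norm (f t - g i t) \<le> 3 * norm (f t)"
        using norm_triangle_ineq4[of "f t" "g i t"] g_bound[of i t] by linarith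
      then show "norm (norm (f t - g i t) powr p) \<le> (3 * norm (f t)) powr p"
        using p by (auto intro!: powr_mono2)
    qed
  qed measurable
  then have "\<forall>\<^sub>F i in sequentially. (LINT t|lebesgue. norm (f t - g i t) powr p) < (e/2) powr p"
    using \<open>0 < e\<close> by (intro order_tendstoD(2)) auto
  then obtain i where "(LINT t|lebesgue. norm (f t - g i t) powr p) < (e/2) powr p"
    by (auto simp: eventually_sequentially)
  then have "Lp_norm p (\<lambda>t. f t - g i t) \<le> e/2"
    using p \<open>0 < e\<close> by (subst Lp_norm_le_iff) auto
  moreover have "translation_continuous p (g i)"
    by (rule translation_continuous_simple[OF p g_simple, where R = "real i"]) (auto simp: g_def)
  ultimately show "\<exists>g\<in>Lp p. translation_continuous p g \<and> Lp_norm p (\<lambda>t. f t - g t) < e"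
    using g[of i] \<open>0 < e\<close> by (intro bexI[of _ "g i"]) auto
qed

section \<open>Unconditional convergence\<close>

lemma Lp_geometric_limit:
  fixes z :: "nat \<Rightarrow> 'v::euclidean_space \<Rightarrow> 'k::{real_normed_field, euclidean_space}"
  assumes p: "1 \<le> p" and z: "\<And>m. z m \<in> Lp p" and x: "x \<in> Lp p"
    and step: "\<And>m. Lp_norm p (\<lambda>t. z (Suc m) t - z m t) \<le> e * (1/2) ^ m"
    and lim: "(\<lambda>k. Lp_norm p (\<lambda>t. x t - z k t)) \<longlonglongrightarrow> 0"
  shows "Lp_norm p (\<lambda>t. x t - z m t) \<le> 2 * e * (1/2) ^ m"
proof (rule LIMSEQ_le_const)
  show "(\<lambda>k. Lp_norm p (\<lambda>t. x t - z k t) + 2 * e * (1/2) ^ m) \<longlonglongrightarrow> 2 * e * (1/2) ^ m"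
    using tendsto_add[OF lim tendsto_const] by simp
  have "Lp_norm p (\<lambda>t. x t - z m t) \<le> Lp_norm p (\<lambda>t. x t - z k t) + 2 * e * (1/2) ^ m" if "m \<le> k" for k
    using Lp_norm_triangle3[OF p x z z, of m k] Lp_geometric_Cauchy[OF p z step that] by simp
  then show "\<exists>N. \<forall>k\<ge>N. Lp_norm p (\<lambda>t. x t - z m t) \<le> Lp_norm p (\<lambda>t. x t - z k t) + 2 * e * (1/2) ^ m"
    by blast
qed

text \<open>On each interval \<open>[n\<^sub>i, n\<^sub>i\<^sub>+\<^sub>1)\<close> the permutation lists the elements of \<open>A\<^sub>i\<close> first. It makes the finite
sets \<open>A\<^sub>i\<close> into blocks of consecutive indices.\<close>

lemma block_permutation:
  fixes n :: "nat \<Rightarrow> nat"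
  assumes n: "strict_mono n" "n 0 = 0" and A: "\<And>i. A i \<subseteq> {n i..<n (Suc i)}"
  obtains \<pi> where "bij \<pi>" "\<And>i. \<pi> ` {n i..<n i + card (A i)} = A i"
proof -
  define I where "I i = {n i..<n (Suc i)}" for i
  have "\<exists>\<sigma>. bij_betw \<sigma> (I i) (I i) \<and> \<sigma> ` {n i..<n i + card (A i)} = A i" for i
  proof -
    have finA: "finite (A i)"
      using A finite_subset by blast
    have le: "card (A i) \<le> card (I i)"
      unfolding I_def by (intro card_mono A) simp
    obtain \<sigma>1 where \<sigma>1: "bij_betw \<sigma>1 {n i..<n i + card (A i)} (A i)"
      using finite_same_card_bij[of "{n i..<n i + card (A i)}" "A i"] finA by auto
    have "card {n i + card (A i)..<n (Suc i)} = card (I i - A i)"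
      using finA A by (subst card_Diff_subset) (auto simp: I_def)
    then obtain \<sigma>2 where \<sigma>2: "bij_betw \<sigma>2 {n i + card (A i)..<n (Suc i)} (I i - A i)"
      using finite_same_card_bij[of "{n i + card (A i)..<n (Suc i)}" "I i - A i"] by (auto simp: I_def)
    define \<sigma> where "\<sigma> m = (if m < n i + card (A i) then \<sigma>1 m else \<sigma>2 m)" for m
    have 1: "bij_betw \<sigma> {n i..<n i + card (A i)} (A i)"
      using \<sigma>1 by (subst bij_betw_cong[of _ _ \<sigma>1]) (auto simp: \<sigma>_def)
    have 2: "bij_betw \<sigma> {n i + card (A i)..<n (Suc i)} (I i - A i)"
      using \<sigma>2 by (subst bij_betw_cong[of _ _ \<sigma>2]) (auto simp: \<sigma>_def)
    have "{n i..<n i + card (A i)} \<union> {n i + card (A i)..<n (Suc i)} = I i"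
      using le by (auto simp: I_def)
    moreover have "A i \<union> (I i - A i) = I i"
      using A by (auto simp: I_def)
    ultimately have "bij_betw \<sigma> (I i) (I i)"
      using bij_betw_combine[OF 1 2] by auto
    then show ?thesis
      using 1 by (auto simp: bij_betw_def)
  qed
  then obtain \<sigma> where \<sigma>: "\<And>i. bij_betw (\<sigma> i) (I i) (I i)" "\<And>i. \<sigma> i ` {n i..<n i + card (A i)} = A i"
    by metis
  have "\<exists>i. m \<in> I i" for m
  proof (induction m)
    case 0
    then show ?case
      using n strict_monoD[OF n(1), of 0 1] by (auto simp: I_def intro!: exI[of _ 0])
  next
    case (Suc m)
    then obtain i where i: "m \<in> I i" by blast
    show ?case
    proof (cases "Suc m < n (Suc i)")
      case True
      then show ?thesis using i by (auto simp: I_def intro!: exI[of _ i])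
    next
      case False
      then have "Suc m = n (Suc i)" using i by (auto simp: I_def)
      then show ?thesis
        using strict_monoD[OF n(1), of "Suc i" "Suc (Suc i)"] by (auto simp: I_def intro!: exI[of _ "Suc i"])
    qed
  qed
  then obtain b where b: "\<And>m. m \<in> I (b m)"
    by metis
  have disj: "i = j" if "m \<in> I i" "m \<in> I j" for m i j
  proof -
    have "\<not> i < j" if "m \<in> I i" "m \<in> I j" for i j
      using that strict_mono_leD[OF n(1), of "Suc i" j] by (auto simp: I_def)
    then show ?thesis
      using that by (meson linorder_neqE_nat)
  qed
  have b_eq: "b m = i" if "m \<in> I i" for m i
    using disj[OF b that] .
  define \<pi> where "\<pi> m = \<sigma> (b m) m" for m
  have \<pi>_in: "\<pi> m \<in> I (b m)" for m
    using bij_betwE[OF \<sigma>(1)] b by (auto simp: \<pi>_def)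
  have "inj \<pi>"
  proof (rule injI)
    fix m m' assume eq: "\<pi> m = \<pi> m'"
    then have "b m = b m'"
      using disj \<pi>_in by metis
    then show "m = m'"
      using eq b \<sigma>(1)[of "b m"] by (metis \<pi>_def bij_betw_def inj_onD)
  qed
  moreover have "surj \<pi>"
  proof (rule surjI[of _ "\<lambda>y. inv_into (I (b y)) (\<sigma> (b y)) y"])
    fix y
    have "y \<in> \<sigma> (b y) ` I (b y)"
      using \<sigma>(1) b by (auto simp: bij_betw_def)
    then show "\<pi> (inv_into (I (b y)) (\<sigma> (b y)) y) = y"
      by (metis \<pi>_def b_eq f_inv_into_f inv_into_into)
  qed
  moreover have "\<pi> ` {n i..<n i + card (A i)} = A i" for i
  proof -
    have "card (A i) \<le> card (I i)"
      unfolding I_def by (intro card_mono A) simp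
    then have "{n i..<n i + card (A i)} \<subseteq> I i"
      using strict_monoD[OF n(1), of i "Suc i"] by (auto simp: I_def)
    then have "\<pi> ` {n i..<n i + card (A i)} = \<sigma> i ` {n i..<n i + card (A i)}"
      by (intro image_cong refl) (metis \<pi>_def b_eq subsetD)
    then show ?thesis
      using \<sigma>(2) by simp
  qed
  ultimately show thesis
    using that by (metis bijI)
qed

text \<open>If the finite sums were unbounded, then beyond any index there would be a finite set of terms whose
sum has norm at least 1. After a block permutation these sets become consecutive, and the partial
sums of the rearranged series are not Cauchy.\<close>

lemma rearrangements_imp_bounded:
  fixes u :: "nat \<Rightarrow> 'v::euclidean_space \<Rightarrow> 'k::{real_normed_field, euclidean_space}"
  assumes p: "1 \<le> p" and u: "\<And>m. u m \<in> Lp p" and x: "x \<in> Lp p"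
    and conv: "\<And>\<pi>. bij \<pi> \<Longrightarrow> (\<lambda>N. Lp_norm p (\<lambda>t. x t - (\<Sum>m<N. u (\<pi> m) t))) \<longlonglongrightarrow> 0"
  obtains B where "\<And>A. finite A \<Longrightarrow> Lp_norm p (\<lambda>t. \<Sum>m\<in>A. u m t) \<le> B"
proof (rule ccontr)
  assume "\<not> thesis"
  then have unbounded: "\<exists>A. finite A \<and> B < Lp_norm p (\<lambda>t. \<Sum>m\<in>A. u m t)" for B
    using that not_le by metis
  have "\<exists>A. finite A \<and> A \<subseteq> {k..} \<and> 1 \<le> Lp_norm p (\<lambda>t. \<Sum>m\<in>A. u m t)" for k
  proof -
    obtain A where A: "finite A" "1 + (\<Sum>m<k. Lp_norm p (u m)) < Lp_norm p (\<lambda>t. \<Sum>m\<in>A. u m t)"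
      using unbounded by blast
    have "Lp_norm p (\<lambda>t. \<Sum>m\<in>A. u m t)
        = Lp_norm p (\<lambda>t. (\<Sum>m\<in>A - {..<k}. u m t) + (\<Sum>m\<in>A \<inter> {..<k}. u m t))"
      using A(1) by (simp add: sum.Int_Diff[of A _ "{..<k}"] add.commute)
    also have "\<dots> \<le> Lp_norm p (\<lambda>t. \<Sum>m\<in>A - {..<k}. u m t) + Lp_norm p (\<lambda>t. \<Sum>m\<in>A \<inter> {..<k}. u m t)"
      by (intro Lp_norm_triangle Lp_sum p u)
    also have "Lp_norm p (\<lambda>t. \<Sum>m\<in>A \<inter> {..<k}. u m t) \<le> (\<Sum>m\<in>A \<inter> {..<k}. Lp_norm p (u m))"
      by (intro Lp_norm_sum_le p u)
    also have "\<dots> \<le> (\<Sum>m<k. Lp_norm p (u m))"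
      by (intro sum_mono2) auto
    finally show ?thesis
      using A by (intro exI[of _ "A - {..<k}"]) auto
  qed
  then obtain A where A: "\<And>k. finite (A k)" "\<And>k. A k \<subseteq> {k..}"
    "\<And>k. 1 \<le> Lp_norm p (\<lambda>t. \<Sum>m\<in>A k. u m t)"
    by metis
  define n where "n = rec_nat 0 (\<lambda>_ m. Suc (m + Max (insert 0 (A m))))"
  have n_simps: "n 0 = 0" "n (Suc i) = Suc (n i + Max (insert 0 (A (n i))))" for i
    by (simp_all add: n_def)
  have mono: "strict_mono n"
    by (simp add: strict_mono_Suc_iff n_simps)
  have block: "A (n i) \<subseteq> {n i..<n (Suc i)}" for i
  proof
    fix m assume "m \<in> A (n i)"
    then have "m \<le> Max (insert 0 (A (n i)))"
      using A(1) by (intro Max_ge) auto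
    then show "m \<in> {n i..<n (Suc i)}"
      using A(2)[of "n i"] \<open>m \<in> A (n i)\<close> by (auto simp: n_simps)
  qed
  obtain \<pi> where \<pi>: "bij \<pi>" "\<And>i. \<pi> ` {n i..<n i + card (A (n i))} = A (n i)"
    using block_permutation[OF mono n_simps(1), of "\<lambda>i. A (n i)"] block by metis
  define S where "S N t = (\<Sum>m<N. u (\<pi> m) t)" for N t
  have S: "S N \<in> Lp p" for N
    unfolding S_def by (intro Lp_sum p u)
  have "\<forall>\<^sub>F N in sequentially. Lp_norm p (\<lambda>t. x t - S N t) < 1/2"
    using order_tendstoD(2)[OF conv[OF \<pi>(1)], of "1/2"] by (simp add: S_def)
  then obtain N where N: "\<And>k. N \<le> k \<Longrightarrow> Lp_norm p (\<lambda>t. x t - S k t) < 1/2"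
    by (auto simp: eventually_sequentially)
  define k where "k = n N"
  have "N \<le> k"
    unfolding k_def using mono by (rule strict_mono_imp_increasing)
  have "S (k + card (A k)) t - S k t = (\<Sum>m\<in>A k. u m t)" for t
  proof -
    have "S (k + card (A k)) t - S k t = (\<Sum>m\<in>{k..<k + card (A k)}. u (\<pi> m) t)"
      unfolding S_def lessThan_atLeast0 by (subst sum_diff_nat_ivl) auto
    also have "\<dots> = (\<Sum>m\<in>\<pi> ` {k..<k + card (A k)}. u m t)"
      using \<pi>(1) by (subst sum.reindex) (auto simp: bij_def intro: inj_on_subset)
    finally show ?thesis
      using \<pi>(2)[of N] by (simp add: k_def)
  qed
  then have "1 \<le> Lp_norm p (\<lambda>t. S (k + card (A k)) t - S k t)"
    using A(3)[of k] by simp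
  also have "\<dots> \<le> Lp_norm p (\<lambda>t. S (k + card (A k)) t - x t) + Lp_norm p (\<lambda>t. x t - S k t)"
    by (intro Lp_norm_triangle3 p S x)
  also have "\<dots> < 1"
    using N[OF \<open>N \<le> k\<close>] N[of "k + card (A k)"] \<open>N \<le> k\<close> by (simp add: Lp_norm_diff_commute[of p _ x])
  finally show False by simp
qed

section \<open>Zabreiko's lemma\<close>

text \<open>The Baire category step: some sublevel set of \<open>\<phi>\<close> is dense in a ball around 0. If not, for each \<open>m\<close> there
are arbitrarily small \<open>z\<close> at positive distance from \<open>{\<phi> \<le> m}\<close>. Adding \<open>z\<close> or \<open>-z\<close> to any given \<open>y\<close> moves
\<open>y\<close> away from \<open>{\<phi> \<le> m}\<close> as well: were \<open>y + z\<close> and \<open>y - z\<close> both close to elements \<open>u\<close>, \<open>v\<close> of that set,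
then \<open>z\<close> would be close to \<open>(u - v) / 2\<close>, which also belongs to it. Iterating over \<open>m\<close> with rapidly
decreasing steps yields a limit outside all sublevel sets, although \<open>\<phi>\<close> is finite there.\<close>

lemma Lp_seminorm_bounded_on_dense:
  fixes \<phi> :: "('v::euclidean_space \<Rightarrow> 'k::{real_normed_field, euclidean_space}) \<Rightarrow> real"
  assumes p: "1 \<le> p"
    and diff: "\<And>x y. x \<in> Lp p \<Longrightarrow> y \<in> Lp p \<Longrightarrow> \<phi> (\<lambda>t. x t - y t) \<le> \<phi> x + \<phi> y"
    and scale: "\<And>r x. x \<in> Lp p \<Longrightarrow> \<phi> (\<lambda>t. r *\<^sub>R x t) \<le> \<bar>r\<bar> * \<phi> x"
  obtains r m where "0 < r" "0 \<le> m"
    "\<And>z e. z \<in> Lp p \<Longrightarrow> Lp_norm p z < r \<Longrightarrow> 0 < e \<Longrightarrow> \<exists>u\<in>Lp p. \<phi> u \<le> m \<and> Lp_norm p (\<lambda>t. z t - u t) < e"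
proof (rule ccontr)
  note finish = that
  assume "\<not> thesis"
  have far: "\<exists>z\<in>Lp p. Lp_norm p z < r \<and> (\<exists>e>0. \<forall>u\<in>Lp p. \<phi> u \<le> m \<longrightarrow> e \<le> Lp_norm p (\<lambda>t. z t - u t))"
    if rm: "0 < r" "0 \<le> m" for r m
  proof (rule ccontr)
    assume contr: "\<not> ?thesis"
    have "\<exists>u\<in>Lp p. \<phi> u \<le> m \<and> Lp_norm p (\<lambda>t. z t - u t) < e"
      if "z \<in> Lp p" "Lp_norm p z < r" "0 < e" for z e
      using contr that by (meson not_le)
    then show False
      using \<open>\<not> thesis\<close> finish[OF rm] by blast
  qed
  \<comment> \<open>states are pairs of a point and a radius; the factor 4 in \<open>Q\<close> leaves room for all later steps,
    which add up to at most \<open>2 r'\<close>\<close>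
  define P where "P = (\<lambda>(y :: 'v \<Rightarrow> 'k, r :: real). y \<in> Lp p \<and> 0 < r)"
  define Q where "Q n = (\<lambda>(y, r) (y', r'). Lp_norm p (\<lambda>t. y' t - y t) < r \<and> r' \<le> r / 2 \<and>
      (\<forall>u\<in>Lp p. \<phi> u \<le> real n \<longrightarrow> 4 * r' \<le> Lp_norm p (\<lambda>t. y' t - u t)))" for n :: nat
  have step: "\<exists>s'. P s' \<and> Q n s s'" if "P s" for s n
  proof -
    obtain y r where s: "s = (y, r)" by fastforce
    have y: "y \<in> Lp p" and r: "0 < r"
      using that by (auto simp: P_def s)
    obtain z e where z: "z \<in> Lp p" "Lp_norm p z < r" "0 < e"
      "\<And>u. u \<in> Lp p \<Longrightarrow> \<phi> u \<le> real n \<Longrightarrow> e \<le> Lp_norm p (\<lambda>t. z t - u t)"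
      using far[OF r, of "real n"] by auto
    \<comment> \<open>the witness is \<open>y + z\<close> or \<open>y - z\<close>\<close>
    have "\<exists>y'\<in>Lp p. Lp_norm p (\<lambda>t. y' t - y t) < r \<and> (\<forall>u\<in>Lp p. \<phi> u \<le> real n \<longrightarrow> e \<le> Lp_norm p (\<lambda>t. y' t - u t))"
    proof (rule ccontr)
      assume contr: "\<not> ?thesis"
      have plus: "(\<lambda>t. y t + z t) \<in> Lp p" and minus: "(\<lambda>t. y t - z t) \<in> Lp p"
        using p y z by (auto intro: Lp_add Lp_diff)
      have "Lp_norm p (\<lambda>t. (y t + z t) - y t) < r" "Lp_norm p (\<lambda>t. (y t - z t) - y t) < r"
        using z(2) Lp_norm_cmult[OF p, of "-1" z] by simp_all
      then obtain u v where u: "u \<in> Lp p" "\<phi> u \<le> real n" "Lp_norm p (\<lambda>t. (y t + z t) - u t) < e"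
        and v: "v \<in> Lp p" "\<phi> v \<le> real n" "Lp_norm p (\<lambda>t. (y t - z t) - v t) < e"
        using contr plus minus by (meson not_le)
      define w where "w t = (1/2) *\<^sub>R (u t - v t)" for t
      have w: "w \<in> Lp p"
        unfolding w_def by (intro Lp_scaleR Lp_diff p u v)
      have "\<phi> w \<le> \<bar>1/2\<bar> * (\<phi> u + \<phi> v)"
        unfolding w_def by (intro order_trans[OF scale] mult_left_mono diff Lp_diff p u v) simp
      then have "\<phi> w \<le> real n"
        using u(2) v(2) by simp
      then have "e \<le> Lp_norm p (\<lambda>t. z t - w t)"
        using z(4) w by blast
      also have "(\<lambda>t. z t - w t) = (\<lambda>t. (1/2) *\<^sub>R (((y t + z t) - u t) - ((y t - z t) - v t)))"
      proof
        fix t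
        have eq: "((y t + z t) - u t) - ((y t - z t) - v t) = 2 *\<^sub>R z t - (u t - v t)"
          by (simp add: scaleR_2)
        show "z t - w t = (1/2) *\<^sub>R (((y t + z t) - u t) - ((y t - z t) - v t))"
          unfolding eq w_def by (simp add: scaleR_diff_right)
      qed
      also have "Lp_norm p \<dots> \<le> (1/2) * (Lp_norm p (\<lambda>t. (y t + z t) - u t) + Lp_norm p (\<lambda>t. (y t - z t) - v t))"
        unfolding Lp_norm_scaleR[OF p]
        using Lp_norm_triangle_diff[OF p Lp_diff[OF p plus u(1)] Lp_diff[OF p minus v(1)]] by simp
      also have "\<dots> < e"
        using u(3) v(3) by simp
      finally show False by simp
    qed
    then obtain y' where "y' \<in> Lp p" "Lp_norm p (\<lambda>t. y' t - y t) < r"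
      "\<And>u. u \<in> Lp p \<Longrightarrow> \<phi> u \<le> real n \<Longrightarrow> e \<le> Lp_norm p (\<lambda>t. y' t - u t)"
      by blast
    then show ?thesis
      using \<open>0 < e\<close> r by (intro exI[of _ "(y', min (r / 2) (e / 4))"]) (fastforce simp: P_def Q_def s min_def)
  qed
  have "P (\<lambda>t. 0, 1)"
    by (simp add: P_def)
  then obtain s where s: "\<And>n. P (s n)" "\<And>n. Q n (s n) (s (Suc n))" "s 0 = (\<lambda>t. 0, 1)"
    using dependent_nat_choice[of "\<lambda>n s. P s \<and> (n = 0 \<longrightarrow> s = (\<lambda>t. 0, 1))" Q] step
    by (smt (verit) nat.distinct(1))
  define y where "y n = fst (s n)" for n
  define r where "r n = snd (s n)" for n
  have y: "y n \<in> Lp p" and r_pos: "0 < r n" for n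
    using s(1)[of n] by (auto simp: P_def y_def r_def split: prod.splits)
  have y_step: "Lp_norm p (\<lambda>t. y (Suc n) t - y n t) < r n" and r_step: "r (Suc n) \<le> r n / 2"
    and y_far: "\<And>u. u \<in> Lp p \<Longrightarrow> \<phi> u \<le> real n \<Longrightarrow> 4 * r (Suc n) \<le> Lp_norm p (\<lambda>t. y (Suc n) t - u t)" for n
    using s(2)[of n] by (auto simp: Q_def y_def r_def split: prod.splits)
  have r_decay: "r (n + i) \<le> r n * (1/2) ^ i" for n i
  proof (induction i)
    case (Suc i)
    then show ?case using r_step[of "n + i"] by simp
  qed simp
  have geo: "Lp_norm p (\<lambda>t. y (Suc (n + i)) t - y (n + i) t) \<le> r n * (1/2) ^ i" for n i
    using y_step[of "n + i"] r_decay[of n i] by linarith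
  obtain x where x: "x \<in> Lp p" "\<And>m. Lp_norm p (\<lambda>t. x t - y m t) \<le> 2 * r 0 * (1/2) ^ m"
    using Lp_complete[OF p, of y "r 0"] y geo[of 0] by auto
  have lim: "(\<lambda>m. Lp_norm p (\<lambda>t. x t - y m t)) \<longlonglongrightarrow> 0"
  proof (rule tendsto_sandwich[OF _ _ tendsto_const])
    show "(\<lambda>m. 2 * r 0 * (1/2) ^ m) \<longlonglongrightarrow> 0"
      by (intro tendsto_mult_right_zero LIMSEQ_power_zero) simp
  qed (use x(2) in auto)
  define n where "n = nat \<lceil>\<phi> x\<rceil>"
  have "\<phi> x \<le> real n"
    unfolding n_def by linarith
  have "Lp_norm p (\<lambda>t. x t - y (Suc n + 0) t) \<le> 2 * r (Suc n) * (1/2) ^ 0"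
    by (rule Lp_geometric_limit[OF p, of "\<lambda>i. y (Suc n + i)"])
      (use y x geo[of "Suc n"] LIMSEQ_ignore_initial_segment[OF lim, of "Suc n"] in \<open>auto simp: add.commute\<close>)
  moreover have "4 * r (Suc n) \<le> Lp_norm p (\<lambda>t. y (Suc n) t - x t)"
    by (rule y_far[OF x(1) \<open>\<phi> x \<le> real n\<close>])
  ultimately show False
    using r_pos[of "Suc n"] by (simp add: Lp_norm_diff_commute[of p x])
qed

text \<open>Zabreiko's lemma: completeness makes a countably subadditive seminorm bounded. Every \<open>x\<close>
of norm at most \<open>a\<close> is within \<open>a / 2\<close> of a point where \<open>\<phi> \<le> K a\<close>, the remainder is approximated in the
same way, and so on; this writes \<open>x\<close> as a series of terms \<open>z\<^sub>n\<close> with \<open>\<phi> z\<^sub>n \<le> K a / 2\<^sup>n\<close>. For a lower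
semicontinuous seminorm a dense sublevel set would settle the claim at once; here \<open>\<phi>\<close> passes to the
limit only along such series.\<close>

lemma Lp_countably_subadditive_seminorm_bounded:
  fixes \<phi> :: "('v::euclidean_space \<Rightarrow> 'k::{real_normed_field, euclidean_space}) \<Rightarrow> real"
  assumes p: "1 \<le> p"
    and diff: "\<And>x y. x \<in> Lp p \<Longrightarrow> y \<in> Lp p \<Longrightarrow> \<phi> (\<lambda>t. x t - y t) \<le> \<phi> x + \<phi> y"
    and scale: "\<And>r x. x \<in> Lp p \<Longrightarrow> \<phi> (\<lambda>t. r *\<^sub>R x t) \<le> \<bar>r\<bar> * \<phi> x"
    and series: "\<And>x z K. x \<in> Lp p \<Longrightarrow> (\<And>n. z n \<in> Lp p) \<Longrightarrow> (\<And>n. \<phi> (z n) \<le> K * (1/2) ^ n) \<Longrightarrow>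
        (\<lambda>M. Lp_norm p (\<lambda>t. x t - (\<Sum>n<M. z n t))) \<longlonglongrightarrow> 0 \<Longrightarrow> \<phi> x \<le> 2 * K"
  obtains C where "0 < C" "\<And>x. x \<in> Lp p \<Longrightarrow> \<phi> x \<le> C * Lp_norm p x"
proof (rule Lp_seminorm_bounded_on_dense[OF p diff scale])
  fix r m :: real
  assume r: "0 < r" "0 \<le> m"
    and dense: "\<And>z e. z \<in> Lp p \<Longrightarrow> Lp_norm p z < r \<Longrightarrow> 0 < e \<Longrightarrow> \<exists>u\<in>Lp p. \<phi> u \<le> m \<and> Lp_norm p (\<lambda>t. z t - u t) < e"
  define K where "K = 2 * m / r"
  \<comment> \<open>rescaling by \<open>r / (2 a)\<close> moves \<open>x\<close> into the ball of radius \<open>r\<close>\<close>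
  have approx: "\<exists>u\<in>Lp p. \<phi> u \<le> K * a \<and> Lp_norm p (\<lambda>t. x t - u t) \<le> a / 2"
    if x: "x \<in> Lp p" "Lp_norm p x \<le> a" "0 < a" for x a
  proof -
    define \<mu> where "\<mu> = r / (2 * a)"
    have \<mu>: "0 < \<mu>" using r that by (simp add: \<mu>_def)
    have "Lp_norm p (\<lambda>t. \<mu> *\<^sub>R x t) \<le> \<mu> * a"
      unfolding Lp_norm_scaleR[OF p] using \<mu> x by simp
    also have "\<dots> < r"
      using r that by (simp add: \<mu>_def)
    finally have small: "Lp_norm p (\<lambda>t. \<mu> *\<^sub>R x t) < r" .
    have "0 < \<mu> * (a / 2)"
      using \<mu> x by simp
    from dense[OF Lp_scaleR[OF x(1)] small this] obtain u where u: "u \<in> Lp p" "\<phi> u \<le> m" "Lp_norm p (\<lambda>t. \<mu> *\<^sub>R x t - u t) < \<mu> * (a / 2)"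
      by blast
    have "\<phi> (\<lambda>t. inverse \<mu> *\<^sub>R u t) \<le> \<bar>inverse \<mu>\<bar> * m"
      using u by (intro order_trans[OF scale] mult_left_mono) auto
    also have "\<dots> = K * a"
      using r that by (simp add: \<mu>_def K_def)
    finally have "\<phi> (\<lambda>t. inverse \<mu> *\<^sub>R u t) \<le> K * a" .
    moreover have "Lp_norm p (\<lambda>t. x t - inverse \<mu> *\<^sub>R u t) \<le> a / 2"
    proof -
      have "Lp_norm p (\<lambda>t. x t - inverse \<mu> *\<^sub>R u t) = \<bar>inverse \<mu>\<bar> * Lp_norm p (\<lambda>t. \<mu> *\<^sub>R x t - u t)"
        unfolding Lp_norm_scaleR[OF p, symmetric] using \<mu> by (simp add: scaleR_diff_right)
      also have "\<dots> \<le> \<bar>inverse \<mu>\<bar> * (\<mu> * (a/2))"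
        using u(3) by (intro mult_left_mono) auto
      also have "\<dots> = a / 2"
        using \<mu> by simp
      finally show ?thesis .
    qed
    ultimately show ?thesis
      using Lp_scaleR[OF u(1), of "inverse \<mu>"] by blast
  qed
  have bound: "\<phi> x \<le> 2 * (K * a)" if x: "x \<in> Lp p" "Lp_norm p x \<le> a" "0 < a" for x a
  proof -
    \<comment> \<open>\<open>R\<close> is the remainder after \<open>n\<close> approximation steps\<close>
    define P where "P n R \<longleftrightarrow> R \<in> Lp p \<and> Lp_norm p R \<le> a * (1/2) ^ n \<and> (n = 0 \<longrightarrow> R = x)" for n R
    have "\<exists>R. P 0 R"
      using x by (auto simp: P_def)
    moreover have "\<exists>R'. P (Suc n) R' \<and> \<phi> (\<lambda>t. R t - R' t) \<le> K * a * (1/2) ^ n" if "P n R" for n R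
    proof -
      have R: "R \<in> Lp p" "Lp_norm p R \<le> a * (1/2) ^ n" and "0 < a * (1/2) ^ n"
        using that \<open>0 < a\<close> by (auto simp: P_def)
      from approx[OF this] obtain u where u: "u \<in> Lp p" "\<phi> u \<le> K * (a * (1/2) ^ n)"
        "Lp_norm p (\<lambda>t. R t - u t) \<le> a * (1/2) ^ n / 2"
        by blast
      have "P (Suc n) (\<lambda>t. R t - u t)"
        using Lp_diff[OF p R(1) u(1)] u(3) by (simp add: P_def)
      moreover have "\<phi> (\<lambda>t. R t - (R t - u t)) \<le> K * a * (1/2) ^ n"
        using u(2) by (simp add: mult.assoc)
      ultimately show ?thesis
        by blast
    qed
    ultimately obtain R where R: "\<And>n. P n (R n)" "\<And>n. \<phi> (\<lambda>t. R n t - R (Suc n) t) \<le> K * a * (1/2) ^ n"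
      using dependent_nat_choice[of P "\<lambda>n R R'. \<phi> (\<lambda>t. R t - R' t) \<le> K * a * (1/2) ^ n"] by blast
    have R0: "R 0 = x" and RL: "R n \<in> Lp p" and Rn: "Lp_norm p (R n) \<le> a * (1/2) ^ n" for n
      using R(1) by (auto simp: P_def)
    have "(\<Sum>n<M. R n t - R (Suc n) t) = x t - R M t" for M t
      using sum_lessThan_telescope'[of "\<lambda>n. R n t" M] R0 by simp
    moreover have "(\<lambda>M. Lp_norm p (R M)) \<longlonglongrightarrow> 0"
    proof (rule tendsto_sandwich[OF _ _ tendsto_const])
      show "(\<lambda>m. a * (1/2) ^ m) \<longlonglongrightarrow> 0"
        by (intro tendsto_mult_right_zero LIMSEQ_power_zero) simp
    qed (use Rn in auto)
    ultimately show ?thesis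
      using series[of x "\<lambda>n t. R n t - R (Suc n) t" "K * a"] x R(2) by (simp add: Lp_diff[OF p RL RL] mult.assoc)
  qed
  show thesis
  proof (rule that)
    show "0 < 2 * K + 1"
      using r by (simp add: K_def add_nonneg_pos)
    show "\<phi> x \<le> (2 * K + 1) * Lp_norm p x" if x: "x \<in> Lp p" for x
    proof (cases "Lp_norm p x = 0")
      case True
      have "\<phi> (\<lambda>t. 0 *\<^sub>R x t) \<le> \<bar>0\<bar> * \<phi> x"
        by (rule scale[OF x])
      then show ?thesis
        using True series[of x "\<lambda>n t. 0" 0] x by simp
    next
      case False
      then have "0 < Lp_norm p x"
        using Lp_norm_nonneg[of p x] by linarith
      then have "\<phi> x \<le> 2 * (K * Lp_norm p x)"
        using bound[OF x order_refl] by blast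
      also have "\<dots> \<le> (2 * K + 1) * Lp_norm p x"
        by (simp add: algebra_simps)
      finally show ?thesis .
    qed
  qed
qed

section \<open>Coordinate projections\<close>

text \<open>An unconditional basis indexed by a set \<open>J\<close> of natural numbers, with its coordinate map \<open>c\<close>. With
\<open>J = UNIV\<close> this is an infinite basis. A finite basis is padded by zero vectors outside \<open>J = {..<N}\<close>, where
the coordinates are required to vanish; this treats both kinds of basis at once.\<close>

locale Lp_unconditional_expansion =
  fixes p :: real and J :: "nat set"
    and xs :: "nat \<Rightarrow> 'v::euclidean_space \<Rightarrow> 'k::{real_normed_field, euclidean_space}"
    and c :: "('v \<Rightarrow> 'k) \<Rightarrow> nat \<Rightarrow> 'k"
  assumes p: "1 \<le> p"
    and xs: "\<And>m. xs m \<in> Lp p"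
    and expansion: "\<And>x \<pi>. x \<in> Lp p \<Longrightarrow> bij \<pi> \<Longrightarrow> Lp_sums p (xs \<circ> \<pi>) (c x \<circ> \<pi>) x"
    and support: "\<And>x m. x \<in> Lp p \<Longrightarrow> m \<notin> J \<Longrightarrow> c x m = 0"
    and unique: "\<And>x b. x \<in> Lp p \<Longrightarrow> Lp_sums p xs b x \<Longrightarrow> (\<And>m. m \<notin> J \<Longrightarrow> b m = 0) \<Longrightarrow> b = c x"
begin

definition proj :: "nat set \<Rightarrow> ('v \<Rightarrow> 'k) \<Rightarrow> 'v \<Rightarrow> 'k" where
  "proj A x t = (\<Sum>m\<in>A. c x m * xs m t)"

definition proj_norm :: "('v \<Rightarrow> 'k) \<Rightarrow> real" where
  "proj_norm x = (SUP A\<in>{A. finite A}. Lp_norm p (proj A x))"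

lemma proj_Lp: "proj A x \<in> Lp p"
  unfolding proj_def[abs_def] by (intro Lp_sum Lp_cmult p xs)

lemma proj_tendsto:
  assumes "x \<in> Lp p"
  shows "(\<lambda>N. Lp_norm p (\<lambda>t. x t - proj {..<N} x t)) \<longlonglongrightarrow> 0"
  using expansion[OF assms bij_id] by (simp add: Lp_sums_def proj_def)

lemma proj_norm_upper:
  assumes "x \<in> Lp p" "finite A"
  shows "Lp_norm p (proj A x) \<le> proj_norm x"
proof -
  obtain B where "\<And>A. finite A \<Longrightarrow> Lp_norm p (\<lambda>t. \<Sum>m\<in>A. c x m * xs m t) \<le> B"
  proof (rule rearrangements_imp_bounded[OF p _ assms(1)])
    show "(\<lambda>t. c x m * xs m t) \<in> Lp p" for m
      by (intro Lp_cmult xs)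
    show "(\<lambda>N. Lp_norm p (\<lambda>t. x t - (\<Sum>m<N. c x (\<pi> m) * xs (\<pi> m) t))) \<longlonglongrightarrow> 0" if "bij \<pi>" for \<pi>
      using expansion[OF assms(1) that] by (simp add: Lp_sums_def)
  qed blast
  then have "bdd_above ((\<lambda>A. Lp_norm p (proj A x)) ` {A. finite A})"
    unfolding proj_def[abs_def] by (intro bdd_aboveI2[where M = B]) auto
  then show ?thesis
    unfolding proj_norm_def using assms(2) by (intro cSUP_upper) auto
qed

lemma proj_norm_least:
  assumes "\<And>A. finite A \<Longrightarrow> Lp_norm p (proj A x) \<le> B"
  shows "proj_norm x \<le> B"
  unfolding proj_norm_def using assms by (intro cSUP_least) auto

lemma coeff_diff:
  assumes x: "x \<in> Lp p" and y: "y \<in> Lp p"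
  shows "c (\<lambda>t. x t - y t) = (\<lambda>m. c x m - c y m)"
proof (rule unique[symmetric])
  show "Lp_sums p xs (\<lambda>m. c x m - c y m) (\<lambda>t. x t - y t)"
    unfolding Lp_sums_def
  proof (rule tendsto_sandwich[OF _ _ tendsto_const])
    show "(\<lambda>N. Lp_norm p (\<lambda>t. x t - proj {..<N} x t) + Lp_norm p (\<lambda>t. y t - proj {..<N} y t)) \<longlonglongrightarrow> 0"
      using tendsto_add[OF proj_tendsto[OF x] proj_tendsto[OF y]] by simp
    have "Lp_norm p (\<lambda>t. (x t - proj {..<N} x t) - (y t - proj {..<N} y t))
        \<le> Lp_norm p (\<lambda>t. x t - proj {..<N} x t) + Lp_norm p (\<lambda>t. y t - proj {..<N} y t)" for N
      by (intro Lp_norm_triangle_diff Lp_diff p x y proj_Lp)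
    moreover have "(\<lambda>t. (x t - proj {..<N} x t) - (y t - proj {..<N} y t))
        = (\<lambda>t. x t - y t - (\<Sum>m<N. (c x m - c y m) * xs m t))" for N
      by (rule ext) (simp add: proj_def left_diff_distrib sum_subtractf)
    ultimately show "\<forall>\<^sub>F N in sequentially. Lp_norm p (\<lambda>t. x t - y t - (\<Sum>m<N. (c x m - c y m) * xs m t))
        \<le> Lp_norm p (\<lambda>t. x t - proj {..<N} x t) + Lp_norm p (\<lambda>t. y t - proj {..<N} y t)"
      by simp
  qed simp
qed (use x y in \<open>simp_all add: Lp_diff[OF p] support\<close>)

lemma coeff_scaleR:
  assumes x: "x \<in> Lp p"
  shows "c (\<lambda>t. r *\<^sub>R x t) = (\<lambda>m. r *\<^sub>R c x m)"
proof (rule unique[symmetric])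
  have "(\<lambda>N. \<bar>r\<bar> * Lp_norm p (\<lambda>t. x t - proj {..<N} x t)) \<longlonglongrightarrow> 0"
    by (intro tendsto_mult_right_zero proj_tendsto x)
  then show "Lp_sums p xs (\<lambda>m. r *\<^sub>R c x m) (\<lambda>t. r *\<^sub>R x t)"
    by (simp add: Lp_sums_def proj_def scaleR_diff_right scaleR_sum_right flip: Lp_norm_scaleR[OF p])
qed (use x in \<open>simp_all add: Lp_scaleR support\<close>)

lemma Lp_sums_finite:
  assumes "\<And>N. m < N \<Longrightarrow> Lp_norm p (\<lambda>t. x t - (\<Sum>j<N. b j * xs j t)) = 0"
  shows "Lp_sums p xs b x"
  unfolding Lp_sums_def
  by (rule tendsto_eventually, rule eventually_mono[OF eventually_gt_at_top[of m]]) (rule assms)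

lemma sum_unit_coeff: "m < N \<Longrightarrow> (\<Sum>j<N. (if j = m then 1 else 0) * xs j t) = xs m t"
  by (subst sum.mono_neutral_right[of _ "{m}"]) auto

lemma coeff_basis_vector:
  assumes "m \<in> J"
  shows "c (xs m) = (\<lambda>j. if j = m then 1 else 0)"
proof (rule unique[OF xs, symmetric])
  show "Lp_sums p xs (\<lambda>j. if j = m then 1 else 0) (xs m)"
    by (rule Lp_sums_finite[of m]) (simp add: sum_unit_coeff)
qed (use assms in auto)

text \<open>A vanishing basis vector would give 0 two different expansions.\<close>

lemma basis_vector_nonzero:
  assumes "m \<in> J"
  shows "0 < Lp_norm p (xs m)"
proof (rule ccontr)
  assume "\<not> 0 < Lp_norm p (xs m)"
  then have 0: "Lp_norm p (xs m) = 0"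
    using Lp_norm_nonneg[of p "xs m"] by linarith
  have "Lp_sums p xs (\<lambda>j. if j = m then 1 else 0) (\<lambda>t. 0)"
    using 0 Lp_norm_cmult[OF p, of "-1" "xs m"] by (intro Lp_sums_finite[of m]) (simp add: sum_unit_coeff)
  then have "(\<lambda>j. if j = m then 1 else 0) = c (\<lambda>t. 0)"
    by (rule unique[OF Lp_zero]) (use assms in auto)
  moreover have "Lp_sums p xs (\<lambda>j. 0) (\<lambda>t. 0)"
    by (intro Lp_sums_finite[of 0]) simp
  then have "(\<lambda>j. 0) = c (\<lambda>t. 0)"
    by (rule unique[OF Lp_zero]) auto
  ultimately show False
    by (metis zero_neq_one)
qed

lemma coeff_le_proj_norm:
  assumes "x \<in> Lp p"
  shows "norm (c x m) * Lp_norm p (xs m) \<le> proj_norm x"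
  using proj_norm_upper[OF assms, of "{m}"] Lp_norm_cmult[OF p, of "c x m" "xs m"]
  by (simp add: proj_def[abs_def])

text \<open>Countable subadditivity of \<open>proj_norm\<close>. As \<open>c\<^sub>j\<close> is dominated by \<open>proj_norm\<close>, the coordinates of the
\<open>z\<^sub>n\<close> add up to numbers \<open>b\<^sub>j\<close>. The partial sums of \<open>\<Sum>\<^sub>j b\<^sub>j x\<^sub>j\<close> are within \<open>2 K / 2\<^sup>M\<close> of the corresponding
partial sums for \<open>z\<^sub>0 + \<dots> + z\<^sub>M\<^sub>-\<^sub>1\<close>, uniformly in their length, so they converge to \<open>x\<close>. By uniqueness the
\<open>b\<^sub>j\<close> are the coordinates of \<open>x\<close>, and the bound is the case \<open>M = 0\<close>.\<close>

lemma proj_norm_series: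
  assumes x: "x \<in> Lp p" and z: "\<And>n. z n \<in> Lp p" and small: "\<And>n. proj_norm (z n) \<le> K * (1/2) ^ n"
    and lim: "(\<lambda>M. Lp_norm p (\<lambda>t. x t - (\<Sum>n<M. z n t))) \<longlonglongrightarrow> 0"
  shows "proj_norm x \<le> 2 * K"
proof -
  have summable_coeff: "summable (\<lambda>n. c (z n) j)" for j
  proof (cases "j \<in> J")
    case True
    note pos = basis_vector_nonzero[OF True]
    have "norm (c (z n) j) \<le> K / Lp_norm p (xs j) * (1/2) ^ n" for n
      using order_trans[OF coeff_le_proj_norm[OF z, of n j] small[of n]] pos by (simp add: field_simps)
    moreover have "summable (\<lambda>n. K / Lp_norm p (xs j) * (1/2) ^ n)"
      by (intro summable_mult summable_geometric) simp
    ultimately show ?thesis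
      by (rule summable_comparison_test'[where N = 0, rotated])
  next
    case False
    then show ?thesis using support[OF z] by simp
  qed
  define b where "b j = (\<Sum>n. c (z n) j)" for j
  define Q where "Q A t = (\<Sum>j\<in>A. b j * xs j t)" for A t
  define w where "w A M t = (\<Sum>n<M. proj A (z n) t)" for A M t
  have Q: "Q A \<in> Lp p" for A
    unfolding Q_def by (intro Lp_sum Lp_cmult p xs)
  have w: "w A M \<in> Lp p" for A M
    unfolding w_def by (intro Lp_sum proj_Lp p)
  have w_lim: "(\<lambda>M. Lp_norm p (\<lambda>t. Q A t - w A M t)) \<longlonglongrightarrow> 0" for A
  proof (rule tendsto_sandwich[OF _ _ tendsto_const])
    have "(\<lambda>M. norm (b j - (\<Sum>n<M. c (z n) j)) * Lp_norm p (xs j)) \<longlonglongrightarrow> 0" for j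
    proof -
      have "(\<lambda>M. b j - (\<Sum>n<M. c (z n) j)) \<longlonglongrightarrow> b j - b j"
        unfolding b_def by (intro tendsto_diff tendsto_const summable_LIMSEQ summable_coeff)
      then show ?thesis
        by (intro tendsto_mult_left_zero tendsto_norm_zero) simp
    qed
    then show "(\<lambda>M. \<Sum>j\<in>A. norm (b j - (\<Sum>n<M. c (z n) j)) * Lp_norm p (xs j)) \<longlonglongrightarrow> 0"
      by (intro tendsto_null_sum)
    have "Lp_norm p (\<lambda>t. Q A t - w A M t) \<le> (\<Sum>j\<in>A. norm (b j - (\<Sum>n<M. c (z n) j)) * Lp_norm p (xs j))" for M
    proof -
      have "(\<lambda>t. Q A t - w A M t) = (\<lambda>t. \<Sum>j\<in>A. (b j - (\<Sum>n<M. c (z n) j)) * xs j t)"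
        by (rule ext) (simp add: Q_def w_def proj_def sum.swap[of _ A] left_diff_distrib sum_subtractf sum_distrib_right)
      then show ?thesis
        using Lp_norm_sum_le[OF p, of A "\<lambda>j t. (b j - (\<Sum>n<M. c (z n) j)) * xs j t"]
        by (simp add: Lp_cmult xs Lp_norm_cmult[OF p])
    qed
    then show "\<forall>\<^sub>F M in sequentially. Lp_norm p (\<lambda>t. Q A t - w A M t)
        \<le> (\<Sum>j\<in>A. norm (b j - (\<Sum>n<M. c (z n) j)) * Lp_norm p (xs j))"
      by simp
  qed simp
  have w_close: "Lp_norm p (\<lambda>t. Q A t - w A M t) \<le> 2 * K * (1/2) ^ M" if "finite A" for A M
  proof (rule Lp_geometric_limit[OF p w Q _ w_lim])
    show "Lp_norm p (\<lambda>t. w A (Suc M) t - w A M t) \<le> K * (1/2) ^ M" for M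
      using order_trans[OF proj_norm_upper[OF z \<open>finite A\<close>] small[of M]] by (simp add: w_def)
  qed
  have "Lp_sums p xs b x"
    unfolding Lp_sums_def
  proof (rule tendstoI)
    fix e :: real assume "0 < e"
    have "(\<lambda>M. Lp_norm p (\<lambda>t. x t - (\<Sum>n<M. z n t)) + 2 * K * (1/2) ^ M) \<longlonglongrightarrow> 0 + 0"
      by (intro tendsto_add lim tendsto_mult_right_zero LIMSEQ_power_zero) simp
    then have "\<forall>\<^sub>F M in sequentially. Lp_norm p (\<lambda>t. x t - (\<Sum>n<M. z n t)) + 2 * K * (1/2) ^ M < e / 2"
      using \<open>0 < e\<close> by (intro order_tendstoD(2)) auto
    then obtain M where M: "Lp_norm p (\<lambda>t. x t - (\<Sum>n<M. z n t)) + 2 * K * (1/2) ^ M < e / 2"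
      by (auto simp: eventually_sequentially)
    have "(\<lambda>N. \<Sum>n<M. Lp_norm p (\<lambda>t. z n t - proj {..<N} (z n) t)) \<longlonglongrightarrow> 0"
      by (intro tendsto_null_sum proj_tendsto z)
    then have "\<forall>\<^sub>F N in sequentially. (\<Sum>n<M. Lp_norm p (\<lambda>t. z n t - proj {..<N} (z n) t)) < e / 2"
      using \<open>0 < e\<close> by (intro order_tendstoD(2)) auto
    then show "\<forall>\<^sub>F N in sequentially. dist (Lp_norm p (\<lambda>t. x t - (\<Sum>m<N. b m * xs m t))) 0 < e"
    proof eventually_elim
      case (elim N)
      have S: "(\<lambda>t. \<Sum>n<M. z n t) \<in> Lp p"
        by (intro Lp_sum p z)
      have "Lp_norm p (\<lambda>t. x t - Q {..<N} t)
        \<le> Lp_norm p (\<lambda>t. x t - (\<Sum>n<M. z n t)) + Lp_norm p (\<lambda>t. (\<Sum>n<M. z n t) - Q {..<N} t)"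
        by (intro Lp_norm_triangle3 p x S Q)
      also have "Lp_norm p (\<lambda>t. (\<Sum>n<M. z n t) - Q {..<N} t)
        \<le> Lp_norm p (\<lambda>t. (\<Sum>n<M. z n t) - w {..<N} M t) + Lp_norm p (\<lambda>t. w {..<N} M t - Q {..<N} t)"
        by (intro Lp_norm_triangle3 p S w Q)
      also have "Lp_norm p (\<lambda>t. w {..<N} M t - Q {..<N} t) \<le> 2 * K * (1/2) ^ M"
        using w_close[of "{..<N}" M] by (simp add: Lp_norm_diff_commute[of p "w _ _"])
      also have "Lp_norm p (\<lambda>t. (\<Sum>n<M. z n t) - w {..<N} M t)
          \<le> (\<Sum>n<M. Lp_norm p (\<lambda>t. z n t - proj {..<N} (z n) t))"
        unfolding w_def sum_subtractf[symmetric] by (intro Lp_norm_sum_le Lp_diff p z proj_Lp)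
      finally show ?case
        using M elim by (simp add: Q_def)
    qed
  qed
  then have b: "b = c x"
    using support[OF z] by (intro unique x) (simp_all add: b_def)
  show ?thesis
  proof (rule proj_norm_least)
    fix A :: "nat set" assume "finite A"
    have "Lp_norm p (Q A) \<le> 2 * K"
      using w_close[OF \<open>finite A\<close>, of 0] by (simp add: w_def)
    then show "Lp_norm p (proj A x) \<le> 2 * K"
      by (simp add: Q_def[abs_def] proj_def[abs_def] b)
  qed
qed

lemma proj_bounded:
  obtains C where "0 < C" "\<And>x A. x \<in> Lp p \<Longrightarrow> finite A \<Longrightarrow> Lp_norm p (proj A x) \<le> C * Lp_norm p x"
proof (rule Lp_countably_subadditive_seminorm_bounded[OF p, where \<phi> = proj_norm])
  show "proj_norm (\<lambda>t. x t - y t) \<le> proj_norm x + proj_norm y" if x: "x \<in> Lp p" and y: "y \<in> Lp p" for x y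
  proof (rule proj_norm_least)
    fix A :: "nat set" assume A: "finite A"
    have "Lp_norm p (proj A (\<lambda>t. x t - y t)) = Lp_norm p (\<lambda>t. proj A x t - proj A y t)"
      unfolding proj_def[abs_def] coeff_diff[OF x y] by (simp add: left_diff_distrib sum_subtractf)
    also have "\<dots> \<le> Lp_norm p (proj A x) + Lp_norm p (proj A y)"
      by (intro Lp_norm_triangle_diff p proj_Lp)
    also have "\<dots> \<le> proj_norm x + proj_norm y"
      by (intro add_mono proj_norm_upper x y A)
    finally show "Lp_norm p (proj A (\<lambda>t. x t - y t)) \<le> proj_norm x + proj_norm y" .
  qed
  show "proj_norm (\<lambda>t. r *\<^sub>R x t) \<le> \<bar>r\<bar> * proj_norm x" if x: "x \<in> Lp p" for r x
  proof (rule proj_norm_least)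
    fix A :: "nat set" assume A: "finite A"
    have "proj A (\<lambda>t. r *\<^sub>R x t) = (\<lambda>t. r *\<^sub>R proj A x t)"
      by (rule ext) (simp add: proj_def coeff_scaleR[OF x] scaleR_sum_right)
    then show "Lp_norm p (proj A (\<lambda>t. r *\<^sub>R x t)) \<le> \<bar>r\<bar> * proj_norm x"
      by (simp add: Lp_norm_scaleR[OF p] mult_left_mono proj_norm_upper[OF x A])
  qed
  show "proj_norm x \<le> 2 * K" if "x \<in> Lp p" "\<And>n. z n \<in> Lp p" "\<And>n. proj_norm (z n) \<le> K * (1/2) ^ n"
    "(\<lambda>M. Lp_norm p (\<lambda>t. x t - (\<Sum>n<M. z n t))) \<longlonglongrightarrow> 0" for x z K
    using that by (rule proj_norm_series)
  fix C :: real
  assume "0 < C" "\<And>x. x \<in> Lp p \<Longrightarrow> proj_norm x \<le> C * Lp_norm p x"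
  then show thesis
    by (intro that[of C]) (blast intro: order_trans[OF proj_norm_upper])+
qed

end

section \<open>Mass on disjoint sets\<close>

definition Lp_mass :: "real \<Rightarrow> 'v::euclidean_space set \<Rightarrow> ('v \<Rightarrow> 'k::{real_normed_field, euclidean_space}) \<Rightarrow> real" where
  "Lp_mass p S f = (LINT t|lebesgue. indicator S t * norm (f t) powr p)"

lemma Lp_mass_le_norm:
  assumes "1 \<le> p" "f \<in> Lp p" "S \<in> sets lebesgue"
  shows "Lp_mass p S f \<le> Lp_norm p f powr p"
  unfolding Lp_mass_def Lp_norm_powr[OF assms(1)]
  by (intro integral_mono Lp_integrable_on Lp_integrable assms) (auto simp: indicator_def)

lemma Lp_mass_eq_norm:
  assumes "1 \<le> p"
  shows "Lp_mass p S f = Lp_norm p (\<lambda>t. indicator S t * f t) powr p"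
proof -
  have "indicator S t * norm (f t) powr p = norm (indicator S t * f t) powr p" for t
    using assms by (auto simp: indicator_def)
  then show ?thesis
    by (simp add: Lp_mass_def Lp_norm_powr[OF assms])
qed

lemma Lp_mass_nonneg: "0 \<le> Lp_mass p S f"
  by (simp add: Lp_mass_def)

lemma Lp_mass_cmult: "Lp_mass p S (\<lambda>t. a * f t) = norm a powr p * Lp_mass p S f"
proof -
  have "Lp_mass p S (\<lambda>t. a * f t) = (LINT t|lebesgue. norm a powr p * (indicator S t * norm (f t) powr p))"
    unfolding Lp_mass_def by (intro Bochner_Integration.integral_cong) (auto simp: norm_mult powr_mult)
  then show ?thesis
    by (simp add: Lp_mass_def)
qed

lemma Lp_mass_translate:
  assumes f: "f \<in> Lp p" and S: "S \<in> sets lebesgue" and T: "\<And>t. t \<in> T \<longleftrightarrow> t - \<gamma> \<in> S"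
  shows "Lp_mass p T (translate \<gamma> f) = Lp_mass p S f"
proof -
  note [measurable] = Lp_measurable[OF f] S
  have "(\<lambda>t. indicator S t * norm (f t) powr p) \<in> borel_measurable lebesgue"
    by measurable
  from integral_lebesgue_translate[OF this, of \<gamma>] show ?thesis
    by (simp add: Lp_mass_def translate_def indicator_def T)
qed

lemma sum_Lp_mass_disjoint:
  assumes f: "f \<in> Lp p" and A: "finite A" "\<And>j. j \<in> A \<Longrightarrow> D j \<in> sets lebesgue" "disjoint_family_on D A"
    and S: "S \<in> sets lebesgue" "\<And>j. j \<in> A \<Longrightarrow> D j \<subseteq> S"
  shows "(\<Sum>j\<in>A. Lp_mass p (D j) f) \<le> Lp_mass p S f"
proof -
  have "(\<Sum>j\<in>A. Lp_mass p (D j) f) = (LINT t|lebesgue. (\<Sum>j\<in>A. indicator (D j) t * norm (f t) powr p))"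
    unfolding Lp_mass_def using A f by (intro Bochner_Integration.integral_sum[symmetric] Lp_integrable_on) auto
  also have "\<dots> \<le> Lp_mass p S f"
    unfolding Lp_mass_def
  proof (intro integral_mono Bochner_Integration.integrable_sum Lp_integrable_on f A S)
    fix t
    have "(\<Sum>j\<in>A. indicator (D j) t :: real) = indicator (\<Union>j\<in>A. D j) t"
      by (rule indicator_UN_disjoint[OF A(1,3), symmetric])
    also have "\<dots> \<le> indicator S t"
      using S(2) by (auto simp: indicator_def)
    finally show "(\<Sum>j\<in>A. indicator (D j) t * norm (f t) powr p) \<le> indicator S t * norm (f t) powr p"
      by (simp add: mult_right_mono flip: sum_distrib_right)
  qed
  finally show ?thesis .
qed

lemma norm_powr_le_mean:
  fixes w u :: "'a::real_normed_vector"
  assumes "1 \<le> p"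
  shows "2 * norm w powr p \<le> norm (w + u) powr p + norm (w - u) powr p"
proof -
  have "norm (2 *\<^sub>R w) \<le> norm (w + u) + norm (w - u)"
    using norm_triangle_ineq[of "w + u" "w - u"] by (simp add: scaleR_2)
  then have "norm w \<le> 1/2 * norm (w + u) + (1 - 1/2) * norm (w - u)"
    by simp
  then have "norm w powr p \<le> (1/2 * norm (w + u) + (1 - 1/2) * norm (w - u)) powr p"
    using assms by (intro powr_mono2) auto
  also have "\<dots> \<le> 1/2 * norm (w + u) powr p + (1 - 1/2) * norm (w - u) powr p"
    using assms by (intro powr_convex_combination) auto
  finally show ?thesis by simp
qed

text \<open>Signs are chosen one term at a time; \<open>B\<close> collects the indices with sign \<open>-1\<close>. Given the current sum
\<open>w\<close>, the average of \<open>\<bar>w + u\<bar>\<^sup>p\<close> and \<open>\<bar>w - u\<bar>\<^sup>p\<close> dominates both \<open>\<bar>w\<bar>\<^sup>p\<close>, which is used on the old sets,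
and \<open>\<bar>u\<bar>\<^sup>p\<close>, which is used on the new one. So one of the two signs preserves the estimate.\<close>

lemma Lp_mass_signs:
  fixes u :: "'i \<Rightarrow> 'v::euclidean_space \<Rightarrow> 'k::{real_normed_field, euclidean_space}"
  assumes p: "1 \<le> p" and "finite A" and u: "\<And>j. u j \<in> Lp p"
    and "\<And>j. j \<in> A \<Longrightarrow> D j \<in> sets lebesgue" "disjoint_family_on D A"
  shows "\<exists>B\<subseteq>A. (\<Sum>j\<in>A. Lp_mass p (D j) (u j))
      \<le> Lp_mass p (\<Union>j\<in>A. D j) (\<lambda>t. (\<Sum>j\<in>A - B. u j t) - (\<Sum>j\<in>B. u j t))"
  using assms(2,4,5)
proof (induction A rule: finite_induct)
  case empty
  then show ?case by (simp add: Lp_mass_def)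
next
  case (insert i A)
  have D: "D i \<in> sets lebesgue" "\<And>j. j \<in> A \<Longrightarrow> D j \<in> sets lebesgue"
    using insert.prems by auto
  have disj: "disjoint_family_on D A" "D i \<inter> (\<Union>j\<in>A. D j) = {}"
    using insert.prems(2) insert.hyps(2) by (auto simp: disjoint_family_on_def)
  define U where "U = (\<Union>j\<in>A. D j)"
  have U: "U \<in> sets lebesgue"
    unfolding U_def using D insert.hyps(1) by (intro sets.finite_UN) auto
  obtain B where B: "B \<subseteq> A" "(\<Sum>j\<in>A. Lp_mass p (D j) (u j))
      \<le> Lp_mass p U (\<lambda>t. (\<Sum>j\<in>A - B. u j t) - (\<Sum>j\<in>B. u j t))"
    using insert.IH D disj(1) unfolding U_def by blast
  define w where "w t = (\<Sum>j\<in>A - B. u j t) - (\<Sum>j\<in>B. u j t)" for t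
  have w: "w \<in> Lp p"
    unfolding w_def by (intro Lp_diff Lp_sum p u)
  have pm: "(\<lambda>t. w t + u i t) \<in> Lp p" "(\<lambda>t. w t - u i t) \<in> Lp p"
    by (intro Lp_add Lp_diff p u w)+
  define V where "V = D i \<union> U"
  have V: "V \<in> sets lebesgue"
    unfolding V_def using D U by auto
  have "2 * (Lp_mass p U w + Lp_mass p (D i) (u i))
      = (LINT t|lebesgue. 2 * (indicator U t * norm (w t) powr p + indicator (D i) t * norm (u i t) powr p))"
    unfolding Lp_mass_def using Lp_integrable_on[OF w U] Lp_integrable_on[OF u D(1), of i] by simp
  also have "\<dots> \<le> (LINT t|lebesgue. indicator V t * norm (w t + u i t) powr p + indicator V t * norm (w t - u i t) powr p)"
  proof (intro integral_mono Bochner_Integration.integrable_mult_right Bochner_Integration.integrable_add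
      Lp_integrable_on w u U V D pm)
    fix t
    have "2 * norm (u i t) powr p \<le> norm (w t + u i t) powr p + norm (w t - u i t) powr p"
      using norm_powr_le_mean[OF p, of "u i t" "w t"] by (simp add: add.commute norm_minus_commute)
    then show "2 * (indicator U t * norm (w t) powr p + indicator (D i) t * norm (u i t) powr p)
       \<le> indicator V t * norm (w t + u i t) powr p + indicator V t * norm (w t - u i t) powr p"
      using norm_powr_le_mean[OF p, of "w t" "u i t"] disj(2)
      by (auto simp: V_def U_def indicator_def)
  qed
  also have "\<dots> = Lp_mass p V (\<lambda>t. w t + u i t) + Lp_mass p V (\<lambda>t. w t - u i t)"
    unfolding Lp_mass_def by (intro Bochner_Integration.integral_add Lp_integrable_on V pm)
  finally have sum: "2 * (Lp_mass p U w + Lp_mass p (D i) (u i))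
      \<le> Lp_mass p V (\<lambda>t. w t + u i t) + Lp_mass p V (\<lambda>t. w t - u i t)" .
  have total: "(\<Sum>j\<in>insert i A. Lp_mass p (D j) (u j)) \<le> Lp_mass p U w + Lp_mass p (D i) (u i)"
    using insert.hyps B(2) by (simp add: w_def[abs_def])
  have finB: "finite B" "i \<notin> B" "finite (A - B)" "i \<notin> A - B"
    using B(1) insert.hyps finite_subset by auto
  have V_eq: "(\<Union>j\<in>insert i A. D j) = V"
    by (simp add: V_def U_def)
  have "a \<le> x \<or> a \<le> y" if "2 * a \<le> x + y" for a x y :: real
    using that by linarith
  from this[OF sum] show ?case
  proof
    assume le: "Lp_mass p U w + Lp_mass p (D i) (u i) \<le> Lp_mass p V (\<lambda>t. w t + u i t)"
    have "insert i A - B = insert i (A - B)"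
      using finB by auto
    then have "(\<lambda>t. w t + u i t) = (\<lambda>t. (\<Sum>j\<in>insert i A - B. u j t) - (\<Sum>j\<in>B. u j t))"
      using finB by (simp add: w_def[abs_def] add.commute add_diff_eq)
    then show ?case
      using order_trans[OF total le] B(1) unfolding V_eq by (intro exI[of _ B]) auto
  next
    assume le: "Lp_mass p U w + Lp_mass p (D i) (u i) \<le> Lp_mass p V (\<lambda>t. w t - u i t)"
    have "insert i A - insert i B = A - B"
      using insert.hyps by auto
    then have "(\<lambda>t. w t - u i t) = (\<lambda>t. (\<Sum>j\<in>insert i A - insert i B. u j t) - (\<Sum>j\<in>insert i B. u j t))"
      using finB by (simp add: w_def[abs_def] algebra_simps)
    then show ?case
      using order_trans[OF total le] B(1) unfolding V_eq by (intro exI[of _ "insert i B"]) auto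
  qed
qed

text \<open>Countably many balls of radius \<open>s\<close> cover the space; if \<open>f\<close> vanished almost everywhere on each of them,
it would vanish almost everywhere.\<close>

lemma Lp_mass_pos_ball:
  fixes f :: "'v::euclidean_space \<Rightarrow> 'k::{real_normed_field, euclidean_space}"
  assumes f: "f \<in> Lp p" "\<not> (AE t in lebesgue. f t = 0)" and s: "0 < s"
  obtains y where "0 < Lp_mass p (ball y s) f"
proof (rule ccontr)
  assume "\<not> thesis"
  then have zero: "Lp_mass p (ball y s) f = 0" for y
    using that[of y] Lp_mass_nonneg[of p "ball y s" f] by force
  have AE_ball: "AE t in lebesgue. t \<in> ball y s \<longrightarrow> f t = 0" for y
  proof -
    have "AE t in lebesgue. indicator (ball y s) t * norm (f t) powr p = 0"
      using integral_nonneg_eq_0_iff_AE[OF Lp_integrable_on[OF f(1), of "ball y s"]] zero[of y]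
      by (simp add: Lp_mass_def)
    then show ?thesis
      by eventually_elim (auto simp: indicator_def split: if_splits)
  qed
  obtain X :: "'v set" where X: "countable X" "\<And>U. open U \<Longrightarrow> U \<noteq> {} \<Longrightarrow> \<exists>d\<in>X. d \<in> U"
    using countable_dense_setE by blast
  have "AE t in lebesgue. \<forall>y\<in>X. t \<in> ball y s \<longrightarrow> f t = 0"
    using X(1) AE_ball by (subst AE_ball_countable) auto
  then have "AE t in lebesgue. f t = 0"
  proof eventually_elim
    case (elim t)
    have "ball t s \<noteq> {}" using s by simp
    then obtain y where "y \<in> X" "y \<in> ball t s"
      using X(2)[of "ball t s"] by auto
    then have "t \<in> ball y s"
      by (simp add: dist_commute)
    then show ?case using elim \<open>y \<in> X\<close> by blast
  qed
  then show False using f(2) by simp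
qed

lemma Lp_norm_translate_diff:
  assumes "1 \<le> p" "f \<in> Lp p"
  shows "Lp_norm p (\<lambda>t. translate a f t - translate b f t) = Lp_norm p (\<lambda>t. translate (a - b) f t - f t)"
proof -
  have "(\<lambda>t. translate (a - b) f t - f t) \<in> Lp p"
    by (intro Lp_diff translate_Lp assms)
  from Lp_norm_translate[OF this, of b] show ?thesis
    by (simp add: translate_def)
qed

lemma powr_add_le_add_powr:
  fixes a b s :: real
  assumes "0 \<le> a" "0 \<le> b" "0 \<le> s" "s \<le> 1"
  shows "(a + b) powr s \<le> a powr s + b powr s"
proof (cases "a + b = 0")
  case False
  then have pos: "0 < a + b" using assms by simp
  have frac: "x \<le> x powr s" if "0 \<le> x" "x \<le> 1" for x
    using powr_mono'[of s 1 x] assms that by simp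
  have "1 = a / (a + b) + b / (a + b)"
    using pos by (simp add: add_divide_distrib[symmetric])
  also have "\<dots> \<le> (a / (a + b)) powr s + (b / (a + b)) powr s"
    using assms pos by (intro add_mono frac) auto
  also have "\<dots> = (a powr s + b powr s) / (a + b) powr s"
    by (simp add: powr_divide add_divide_distrib)
  finally show ?thesis
    using pos by (simp add: le_divide_eq)
qed (use assms in auto)

lemma powr_sum_le_sum_powr:
  fixes a :: "'i \<Rightarrow> real"
  assumes "0 \<le> s" "s \<le> 1" "\<And>i. i \<in> A \<Longrightarrow> 0 \<le> a i"
  shows "(\<Sum>i\<in>A. a i) powr s \<le> (\<Sum>i\<in>A. a i powr s)"
  using assms(3)
proof (induction A rule: infinite_finite_induct)
  case (insert i A)
  then have "(a i + (\<Sum>i\<in>A. a i)) powr s \<le> a i powr s + (\<Sum>i\<in>A. a i) powr s"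
    using assms by (intro powr_add_le_add_powr sum_nonneg) auto
  then show ?case using insert by fastforce
qed simp_all

text \<open>This is where \<open>p \<le> 2\<close> enters: the Cauchy-Schwarz inequality followed by \<open>\<parallel>a\<parallel>\<^sub>2 \<le> \<parallel>a\<parallel>\<^sub>p\<close> for both factors.\<close>

lemma sum_mult_powr_le:
  fixes a b :: "'i \<Rightarrow> real"
  assumes p: "1 \<le> p" "p \<le> 2" and nonneg: "\<And>i. i \<in> A \<Longrightarrow> 0 \<le> a i" "\<And>i. i \<in> A \<Longrightarrow> 0 \<le> b i"
  shows "(\<Sum>i\<in>A. a i * b i) powr p \<le> (\<Sum>i\<in>A. a i powr p) * (\<Sum>i\<in>A. b i powr p)"
proof -
  have sq: "(\<Sum>i\<in>A. (x i)\<^sup>2) powr (p/2) \<le> (\<Sum>i\<in>A. x i powr p)" if "\<And>i. i \<in> A \<Longrightarrow> 0 \<le> x i" for x :: "'i \<Rightarrow> real"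
  proof -
    have "((x i)\<^sup>2) powr (p/2) = x i powr p" if "i \<in> A" for i
      using \<open>\<And>i. i \<in> A \<Longrightarrow> 0 \<le> x i\<close>[OF that] by (simp add: powr_powr flip: powr_numeral)
    then show ?thesis
      using powr_sum_le_sum_powr[of "p/2" A "\<lambda>i. (x i)\<^sup>2"] p by simp
  qed
  have s: "0 \<le> (\<Sum>i\<in>A. a i * b i)"
    using nonneg by (intro sum_nonneg) auto
  have "(\<Sum>i\<in>A. a i * b i) powr p = ((\<Sum>i\<in>A. a i * b i)\<^sup>2) powr (p/2)"
    using s by (simp add: powr_powr flip: powr_numeral)
  also have "\<dots> \<le> ((\<Sum>i\<in>A. (a i)\<^sup>2) * (\<Sum>i\<in>A. (b i)\<^sup>2)) powr (p/2)"
    using p by (intro powr_mono2 Cauchy_Schwarz_ineq_sum) auto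
  also have "\<dots> = (\<Sum>i\<in>A. (a i)\<^sup>2) powr (p/2) * (\<Sum>i\<in>A. (b i)\<^sup>2) powr (p/2)"
    by (rule powr_mult)
  also have "\<dots> \<le> (\<Sum>i\<in>A. a i powr p) * (\<Sum>i\<in>A. b i powr p)"
    using nonneg by (intro mult_mono sq sum_nonneg) auto
  finally show ?thesis .
qed

lemma many_disjoint_balls:
  fixes r :: real and H :: nat
  assumes "0 < r"
  obtains E :: "nat \<Rightarrow> 'v::euclidean_space set" where "disjoint_family_on E {..<H}"
    "\<And>i. i < H \<Longrightarrow> E i \<subseteq> ball 0 r" "\<And>i. E i \<in> lmeasurable" "\<And>i. 0 < measure lebesgue (E i)"
proof -
  obtain b :: 'v where b: "b \<in> Basis" using nonempty_Basis by blast
  define s where "s = r / (real H + 1)"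
  have s: "0 < s" using assms by (simp add: s_def add_nonneg_pos)
  \<comment> \<open>centres in steps of \<open>s\<close> along one coordinate axis\<close>
  define E where "E i = ball ((real i * s) *\<^sub>R b) (s / 2)" for i
  show thesis
  proof (rule that)
    show "disjoint_family_on E {..<H}"
      unfolding disjoint_family_on_def
    proof (intro ballI impI)
      fix i j :: nat assume "i \<noteq> j"
      then have "1 \<le> \<bar>real i - real j\<bar>" by linarith
      then have "s / 2 + s / 2 \<le> \<bar>real i - real j\<bar> * s"
        using s by simp
      also have "\<dots> = dist ((real i * s) *\<^sub>R b) ((real j * s) *\<^sub>R b)"
        using s b by (simp add: dist_norm abs_mult flip: scaleR_diff_left left_diff_distrib)
      finally show "E i \<inter> E j = {}"
        unfolding E_def by (rule disjoint_ballI)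
    qed
    show "E i \<subseteq> ball 0 r" if "i < H" for i
    proof -
      have "real i * s + s / 2 \<le> real H * s + 1 * s"
        using that s by (intro add_mono mult_right_mono) auto
      also have "\<dots> = (real H + 1) * s"
        by (simp add: distrib_right)
      also have "\<dots> = r"
        by (simp add: s_def)
      finally show ?thesis
        using s b unfolding E_def by (subst ball_subset_ball_iff) (simp add: dist_norm)
    qed
    show "E i \<in> lmeasurable" "0 < measure lebesgue (E i)" for i
      using s content_ball_pos[of "s / 2" "(real i * s) *\<^sub>R b"]
      by (auto simp: E_def)
  qed
qed

section \<open>Bases of translates\<close>

text \<open>Each basis vector \<open>x\<^sub>m\<close> is the translate by \<open>g m\<close> of one of finitely many functions; \<open>\<kappa> m\<close> says of which.\<close>

locale Lp_translate_expansion = Lp_unconditional_expansion p J xs c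
  for p :: real and J :: "nat set"
    and xs :: "nat \<Rightarrow> 'v::euclidean_space \<Rightarrow> 'k::{real_normed_field, euclidean_space}"
    and c :: "('v \<Rightarrow> 'k) \<Rightarrow> nat \<Rightarrow> 'k" +
  fixes K :: "'l set" and f :: "'l \<Rightarrow> 'v \<Rightarrow> 'k" and \<kappa> :: "nat \<Rightarrow> 'l" and g :: "nat \<Rightarrow> 'v"
  assumes finite_K: "finite K"
    and \<kappa>: "\<And>m. m \<in> J \<Longrightarrow> \<kappa> m \<in> K"
    and translates: "\<And>m. m \<in> J \<Longrightarrow> xs m = translate (g m) (f (\<kappa> m))"
    and f_Lp: "\<And>k. k \<in> K \<Longrightarrow> f k \<in> Lp p"
    and f_nonzero: "\<And>k. k \<in> K \<Longrightarrow> \<not> (AE t in lebesgue. f k t = 0)"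
begin

text \<open>The projection onto the \<open>i\<close>-th coordinate maps \<open>x\<^sub>i - x\<^sub>j\<close> to \<open>x\<^sub>i\<close>, so \<open>\<parallel>x\<^sub>i\<parallel> \<le> C \<parallel>x\<^sub>i - x\<^sub>j\<parallel>\<close>. Two translates of
the same function with close centres violate this by continuity of translation.\<close>

lemma centres_separated:
  obtains r where "0 < r" "\<And>i j. i \<in> J \<Longrightarrow> j \<in> J \<Longrightarrow> i \<noteq> j \<Longrightarrow> \<kappa> i = \<kappa> j \<Longrightarrow> r \<le> dist (g i) (g j)"
proof -
  obtain C where C: "0 < C" "\<And>x A. x \<in> Lp p \<Longrightarrow> finite A \<Longrightarrow> Lp_norm p (proj A x) \<le> C * Lp_norm p x"
    using proj_bounded by blast
  have apart: "Lp_norm p (xs i) \<le> C * Lp_norm p (\<lambda>t. xs i t - xs j t)" if "i \<in> J" "j \<in> J" "i \<noteq> j" for i j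
  proof -
    have "proj {i} (\<lambda>t. xs i t - xs j t) = xs i"
      using that by (simp add: proj_def[abs_def] coeff_diff[OF xs xs] coeff_basis_vector)
    then show ?thesis
      using C(2)[OF Lp_diff[OF p xs xs], of "{i}" i j] by simp
  qed
  have "\<exists>d>0. \<forall>h. norm h < d \<longrightarrow> C * Lp_norm p (\<lambda>t. translate h (f k) t - f k t) < Lp_norm p (f k)" if "k \<in> K" for k
  proof -
    have "0 < Lp_norm p (f k)"
      using Lp_norm_eq_0_iff[OF p f_Lp[OF that]] f_nonzero[OF that] Lp_norm_nonneg[of p "f k"] by linarith
    moreover have "((\<lambda>h. C * Lp_norm p (\<lambda>t. translate h (f k) t - f k t)) \<longlongrightarrow> 0) (nhds 0)"
      using translation_continuous_Lp[OF p f_Lp[OF that]]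
      unfolding translation_continuous_def by (rule tendsto_mult_right_zero)
    ultimately have "\<forall>\<^sub>F h in nhds 0. C * Lp_norm p (\<lambda>t. translate h (f k) t - f k t) < Lp_norm p (f k)"
      by (intro order_tendstoD(2)) auto
    then show ?thesis
      by (simp add: eventually_nhds_metric dist_norm)
  qed
  then obtain d where d: "\<And>k. k \<in> K \<Longrightarrow> 0 < d k"
    "\<And>k h. k \<in> K \<Longrightarrow> norm h < d k \<Longrightarrow> C * Lp_norm p (\<lambda>t. translate h (f k) t - f k t) < Lp_norm p (f k)"
    by metis
  define r where "r = Min (insert 1 (d ` K))"
  have r: "0 < r" "\<And>k. k \<in> K \<Longrightarrow> r \<le> d k"
    using finite_K d(1) by (auto simp: r_def)
  show thesis
  proof (rule that[OF r(1)])
    fix i j assume ij: "i \<in> J" "j \<in> J" "i \<noteq> j" "\<kappa> i = \<kappa> j"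
    note k = \<kappa>[OF ij(1)]
    show "r \<le> dist (g i) (g j)"
    proof (rule ccontr)
      assume "\<not> r \<le> dist (g i) (g j)"
      then have "norm (g i - g j) < d (\<kappa> i)"
        using r(2)[OF k] by (simp add: dist_norm)
      then have "C * Lp_norm p (\<lambda>t. translate (g i - g j) (f (\<kappa> i)) t - f (\<kappa> i) t) < Lp_norm p (f (\<kappa> i))"
        by (rule d(2)[OF k])
      moreover have "Lp_norm p (xs i) = Lp_norm p (f (\<kappa> i))"
        using translates[OF ij(1)] Lp_norm_translate[OF f_Lp[OF k]] by simp
      moreover have "Lp_norm p (\<lambda>t. xs i t - xs j t)
          = Lp_norm p (\<lambda>t. translate (g i - g j) (f (\<kappa> i)) t - f (\<kappa> i) t)"
        using Lp_norm_translate_diff[OF p f_Lp[OF k], of "g i" "g j"] translates[OF ij(1)] translates[OF ij(2)] ij(4)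
        by simp
      ultimately show False
        using apart[OF ij(1-3)] by simp
    qed
  qed
qed

text \<open>The function \<open>h\<close> will be \<open>g\<close> followed by a translation, or by a reflection.\<close>

lemma disjoint_balls_at_centres:
  assumes r: "\<And>i j. i \<in> J \<Longrightarrow> j \<in> J \<Longrightarrow> i \<noteq> j \<Longrightarrow> \<kappa> i = \<kappa> j \<Longrightarrow> r \<le> dist (g i) (g j)"
    and A: "A \<subseteq> {j \<in> J. \<kappa> j = k}"
    and h: "\<And>i j. dist (h i) (h j) = dist (g i) (g j)"
  shows "disjoint_family_on (\<lambda>j. ball (h j) (r / 2)) A"
  unfolding disjoint_family_on_def
proof (intro ballI impI)
  fix i j assume "i \<in> A" "j \<in> A" "i \<noteq> j"
  then have "r / 2 + r / 2 \<le> dist (h i) (h j)"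
    using r[of i j] A h[of i j] by auto
  then show "ball (h i) (r / 2) \<inter> ball (h j) (r / 2) = {}"
    by (rule disjoint_ballI)
qed

lemma sum_over_classes:
  assumes "finite A" "A \<subseteq> J"
  shows "(\<Sum>j\<in>A. F j) = (\<Sum>k\<in>K. \<Sum>j\<in>{j \<in> A. \<kappa> j = k}. F j :: real)"
  using assms \<kappa> by (intro sum.group[symmetric] finite_K) auto

text \<open>For each class \<open>k\<close> choose a ball of radius \<open>r/2\<close> on which \<open>f\<^sub>k\<close> has mass \<open>\<delta>\<^sub>k > 0\<close>. Its translates \<open>D\<^sub>j\<close> are
disjoint, and \<open>c\<^sub>j x\<^sub>j\<close> has mass \<open>\<bar>c\<^sub>j\<bar>\<^sup>p \<delta>\<^sub>k\<close> on \<open>D\<^sub>j\<close>. The signed sum provided by \<open>Lp_mass_signs\<close> is a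
difference of two coordinate projections of \<open>x\<close>, hence of norm at most \<open>2 C \<parallel>x\<parallel>\<close>.\<close>

lemma lower_p_estimate:
  obtains B where "0 < B"
    "\<And>x A. x \<in> Lp p \<Longrightarrow> finite A \<Longrightarrow> A \<subseteq> J \<Longrightarrow> (\<Sum>j\<in>A. norm (c x j) powr p) \<le> B * Lp_norm p x powr p"
proof -
  obtain C where C: "0 < C" "\<And>x A. x \<in> Lp p \<Longrightarrow> finite A \<Longrightarrow> Lp_norm p (proj A x) \<le> C * Lp_norm p x"
    using proj_bounded by blast
  obtain r where r: "0 < r"
    "\<And>i j. i \<in> J \<Longrightarrow> j \<in> J \<Longrightarrow> i \<noteq> j \<Longrightarrow> \<kappa> i = \<kappa> j \<Longrightarrow> r \<le> dist (g i) (g j)"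
    using centres_separated by blast
  have "\<exists>y. 0 < Lp_mass p (ball y (r / 2)) (f k)" if "k \<in> K" for k
    using Lp_mass_pos_ball[OF f_Lp[OF that] f_nonzero[OF that], of "r / 2"] r(1) by auto
  then obtain y where y: "\<And>k. k \<in> K \<Longrightarrow> 0 < Lp_mass p (ball (y k) (r / 2)) (f k)"
    by metis
  define \<delta> where "\<delta> k = Lp_mass p (ball (y k) (r / 2)) (f k)" for k
  have class_bound: "(\<Sum>j\<in>A. norm (c x j) powr p) \<le> (2 * C) powr p / \<delta> k * Lp_norm p x powr p"
    if x: "x \<in> Lp p" and A: "finite A" "A \<subseteq> {j \<in> J. \<kappa> j = k}" and k: "k \<in> K" for x A k
  proof -
    define D where "D j = ball (y k + g j) (r / 2)" for j
    define u where "u j t = c x j * xs j t" for j t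
    have u: "u j \<in> Lp p" for j
      unfolding u_def by (intro Lp_cmult xs)
    have mass: "Lp_mass p (D j) (u j) = norm (c x j) powr p * \<delta> k" if "j \<in> A" for j
    proof -
      have j: "j \<in> J" "\<kappa> j = k" using A(2) that by auto
      have "Lp_mass p (D j) (translate (g j) (f k)) = \<delta> k"
        unfolding \<delta>_def
        by (rule Lp_mass_translate[OF f_Lp[OF k]]) (auto simp: D_def dist_norm algebra_simps)
      then show ?thesis
        unfolding u_def Lp_mass_cmult using translates[OF j(1)] j(2) by simp
    qed
    have D: "D j \<in> sets lebesgue" for j
      by (simp add: D_def)
    have "disjoint_family_on D A"
      unfolding D_def by (rule disjoint_balls_at_centres[OF r(2) A(2)]) (auto simp: dist_norm)
    then have "\<exists>S\<subseteq>A. (\<Sum>j\<in>A. Lp_mass p (D j) (u j))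
        \<le> Lp_mass p (\<Union>j\<in>A. D j) (\<lambda>t. (\<Sum>j\<in>A - S. u j t) - (\<Sum>j\<in>S. u j t))"
      by (intro Lp_mass_signs p A(1) u D)
    then obtain S where "S \<subseteq> A \<and> (\<Sum>j\<in>A. Lp_mass p (D j) (u j))
        \<le> Lp_mass p (\<Union>j\<in>A. D j) (\<lambda>t. (\<Sum>j\<in>A - S. u j t) - (\<Sum>j\<in>S. u j t))"
      by (rule exE)
    note S = conjunct1[OF this] conjunct2[OF this]
    have w: "(\<lambda>t. (\<Sum>j\<in>A - S. u j t) - (\<Sum>j\<in>S. u j t)) = (\<lambda>t. proj (A - S) x t - proj S x t)"
      by (simp add: u_def proj_def)
    have "Lp_norm p (\<lambda>t. proj (A - S) x t - proj S x t) \<le> Lp_norm p (proj (A - S) x) + Lp_norm p (proj S x)"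
      by (intro Lp_norm_triangle_diff p proj_Lp)
    also have "\<dots> \<le> C * Lp_norm p x + C * Lp_norm p x"
      using A(1) S(1) by (intro add_mono C(2) x) (auto intro: finite_subset)
    finally have norm_w: "Lp_norm p (\<lambda>t. proj (A - S) x t - proj S x t) \<le> 2 * C * Lp_norm p x"
      by simp
    have "(\<Sum>j\<in>A. norm (c x j) powr p) * \<delta> k = (\<Sum>j\<in>A. Lp_mass p (D j) (u j))"
      by (simp add: mass sum_distrib_right)
    also have "\<dots> \<le> Lp_norm p (\<lambda>t. proj (A - S) x t - proj S x t) powr p"
    proof (rule order_trans[OF S(2)])
      show "Lp_mass p (\<Union>j\<in>A. D j) (\<lambda>t. (\<Sum>j\<in>A - S. u j t) - (\<Sum>j\<in>S. u j t))
          \<le> Lp_norm p (\<lambda>t. proj (A - S) x t - proj S x t) powr p"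
        unfolding w using A(1) D by (intro Lp_mass_le_norm Lp_diff p proj_Lp sets.finite_UN) auto
    qed
    also have "\<dots> \<le> (2 * C * Lp_norm p x) powr p"
      using p norm_w by (intro powr_mono2) auto
    also have "\<dots> = (2 * C) powr p * Lp_norm p x powr p"
      by (rule powr_mult)
    finally show ?thesis
      using y[OF k] by (simp add: \<delta>_def field_simps)
  qed
  define B where "B = 1 + (\<Sum>k\<in>K. (2 * C) powr p / \<delta> k)"
  have "0 < B"
    unfolding B_def by (intro add_pos_nonneg sum_nonneg) (simp_all add: \<delta>_def Lp_mass_nonneg)
  show thesis
  proof (rule that[OF \<open>0 < B\<close>])
    fix x :: "'v \<Rightarrow> 'k" and A assume x: "x \<in> Lp p" and A: "finite A" "A \<subseteq> J"
    have "(\<Sum>j\<in>A. norm (c x j) powr p) = (\<Sum>k\<in>K. \<Sum>j\<in>{j \<in> A. \<kappa> j = k}. norm (c x j) powr p)"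
      by (rule sum_over_classes[OF A])
    also have "\<dots> \<le> (\<Sum>k\<in>K. (2 * C) powr p / \<delta> k * Lp_norm p x powr p)"
      using A by (intro sum_mono class_bound x) auto
    also have "\<dots> = (\<Sum>k\<in>K. (2 * C) powr p / \<delta> k) * Lp_norm p x powr p"
      by (rule sum_distrib_right[symmetric])
    also have "\<dots> \<le> B * Lp_norm p x powr p"
      unfolding B_def by (intro mult_right_mono) auto
    finally show "(\<Sum>j\<in>A. norm (c x j) powr p) \<le> B * Lp_norm p x powr p" .
  qed
qed

text \<open>Translating back, the mass of \<open>x\<^sub>j\<close> on the ball around 0 becomes the mass of \<open>f\<^sub>k\<close> on the ball around
\<open>- g j\<close>. Within one class these balls are disjoint, so they carry at most the total mass of \<open>f\<^sub>k\<close>.\<close>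

lemma local_mass_bounded:
  obtains r L where "0 < r"
    "\<And>A. finite A \<Longrightarrow> A \<subseteq> J \<Longrightarrow> (\<Sum>j\<in>A. Lp_mass p (ball 0 r) (xs j)) \<le> L"
proof -
  obtain r where r: "0 < r"
    "\<And>i j. i \<in> J \<Longrightarrow> j \<in> J \<Longrightarrow> i \<noteq> j \<Longrightarrow> \<kappa> i = \<kappa> j \<Longrightarrow> r \<le> dist (g i) (g j)"
    using centres_separated by blast
  show thesis
  proof (rule that)
    show "0 < r / 2" using r(1) by simp
    fix A assume A: "finite A" "A \<subseteq> J"
    have "(\<Sum>j\<in>A. Lp_mass p (ball 0 (r / 2)) (xs j))
        = (\<Sum>k\<in>K. \<Sum>j\<in>{j \<in> A. \<kappa> j = k}. Lp_mass p (ball 0 (r / 2)) (xs j))"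
      by (rule sum_over_classes[OF A])
    also have "\<dots> \<le> (\<Sum>k\<in>K. Lp_mass p UNIV (f k))"
    proof (rule sum_mono)
      fix k assume k: "k \<in> K"
      have "Lp_mass p (ball 0 (r / 2)) (xs j) = Lp_mass p (ball (- g j) (r / 2)) (f k)" if "j \<in> {j \<in> A. \<kappa> j = k}" for j
      proof -
        have "Lp_mass p (ball 0 (r / 2)) (translate (g j) (f k)) = Lp_mass p (ball (- g j) (r / 2)) (f k)"
          by (rule Lp_mass_translate[OF f_Lp[OF k]]) (auto simp: dist_norm norm_minus_commute)
        then show ?thesis
          using that A translates by auto
      qed
      then have "(\<Sum>j\<in>{j \<in> A. \<kappa> j = k}. Lp_mass p (ball 0 (r / 2)) (xs j))
          = (\<Sum>j\<in>{j \<in> A. \<kappa> j = k}. Lp_mass p (ball (- g j) (r / 2)) (f k))"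
        by (intro sum.cong) auto
      also have "\<dots> \<le> Lp_mass p UNIV (f k)"
      proof (rule sum_Lp_mass_disjoint[OF f_Lp[OF k]])
        show "disjoint_family_on (\<lambda>j. ball (- g j) (r / 2)) {j \<in> A. \<kappa> j = k}"
          by (rule disjoint_balls_at_centres[OF r(2), of _ k]) (use A in \<open>auto simp: dist_norm norm_minus_commute\<close>)
      qed (use A in auto)
      finally show "(\<Sum>j\<in>{j \<in> A. \<kappa> j = k}. Lp_mass p (ball 0 (r / 2)) (xs j)) \<le> Lp_mass p UNIV (f k)" .
    qed
    finally show "(\<Sum>j\<in>A. Lp_mass p (ball 0 (r / 2)) (xs j)) \<le> (\<Sum>k\<in>K. Lp_mass p UNIV (f k))" .
  qed
qed

text \<open>The important point is that \<open>\<beta>\<close> does not depend on \<open>E\<close>: in the estimate for the expansion of the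
indicator of \<open>E\<close>, the measure of \<open>E\<close> is both the left-hand side and, by the lower \<open>p\<close>-estimate, a
factor on the right.\<close>

lemma mass_on_every_set:
  assumes "p \<le> 2"
  obtains \<beta> where "0 < \<beta>"
    "\<And>E. E \<in> lmeasurable \<Longrightarrow> 0 < measure lebesgue E \<Longrightarrow>
       \<forall>\<^sub>F M in sequentially. \<beta> \<le> (\<Sum>j\<in>{..<M} \<inter> J. Lp_mass p E (xs j))"
proof -
  obtain B where B: "0 < B"
    "\<And>x A. x \<in> Lp p \<Longrightarrow> finite A \<Longrightarrow> A \<subseteq> J \<Longrightarrow> (\<Sum>j\<in>A. norm (c x j) powr p) \<le> B * Lp_norm p x powr p"
    using lower_p_estimate by blast
  define \<beta> where "\<beta> = (1/2) powr p / B"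
  show thesis
  proof (rule that)
    show "0 < \<beta>" using B by (simp add: \<beta>_def)
    fix E :: "'v set" assume E: "E \<in> lmeasurable" "0 < measure lebesgue E"
    then have [measurable]: "E \<in> sets lebesgue"
      by (simp add: fmeasurableD)
    define x where "x = (indicator E :: 'v \<Rightarrow> 'k)"
    have x: "x \<in> Lp p" and norm_x: "Lp_norm p x = measure lebesgue E powr (1/p)"
      unfolding x_def by (intro Lp_indicator p E)+
    have powr_norm_x: "Lp_norm p x powr p = measure lebesgue E"
      using p E by (simp add: norm_x powr_powr)
    have "0 < Lp_norm p x"
      using E by (simp add: norm_x)
    then have "\<forall>\<^sub>F M in sequentially. Lp_norm p (\<lambda>t. x t - proj {..<M} x t) < Lp_norm p x / 2"
      by (intro order_tendstoD(2)[OF proj_tendsto[OF x]]) simp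
    then show "\<forall>\<^sub>F M in sequentially. \<beta> \<le> (\<Sum>j\<in>{..<M} \<inter> J. Lp_mass p E (xs j))"
    proof eventually_elim
      case (elim M)
      define A where "A = {..<M} \<inter> J"
      have A: "finite A" "A \<subseteq> J" by (auto simp: A_def)
      define s where "s = proj {..<M} x"
      have s: "s \<in> Lp p" unfolding s_def by (rule proj_Lp)
      have s_eq: "s t = (\<Sum>j\<in>A. c x j * xs j t)" for t
        unfolding s_def proj_def using support[OF x] by (intro sum.mono_neutral_right) (auto simp: A_def)
      \<comment> \<open>\<open>s\<close> is within half the norm of \<open>x\<close>, so its restriction to \<open>E\<close> keeps the other half\<close>
      have "Lp_norm p x = Lp_norm p (\<lambda>t. indicator E t * (x t - s t) + indicator E t * s t)"
        by (intro arg_cong[where f = "Lp_norm p"] ext) (simp add: x_def indicator_def)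
      also have "\<dots> \<le> Lp_norm p (\<lambda>t. indicator E t * (x t - s t)) + Lp_norm p (\<lambda>t. indicator E t * s t)"
        by (intro Lp_norm_triangle Lp_restrict Lp_diff p x s) auto
      also have "Lp_norm p (\<lambda>t. indicator E t * (x t - s t)) \<le> Lp_norm p (\<lambda>t. x t - s t)"
        by (intro Lp_norm_mono Lp_diff p x s) (auto simp: indicator_def)
      finally have "1/2 * Lp_norm p x \<le> Lp_norm p (\<lambda>t. indicator E t * s t)"
        using elim by (simp add: s_def)
      then have "(1/2 * Lp_norm p x) powr p \<le> Lp_norm p (\<lambda>t. indicator E t * s t) powr p"
        using p by (intro powr_mono2) auto
      then have "(1/2) powr p * measure lebesgue E \<le> Lp_mass p E s"
        unfolding powr_mult powr_norm_x Lp_mass_eq_norm[OF p] .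
      also have "\<dots> \<le> (LINT t|lebesgue. B * measure lebesgue E * (\<Sum>j\<in>A. indicator E t * norm (xs j t) powr p))"
        unfolding Lp_mass_def
      proof (intro integral_mono Lp_integrable_on Bochner_Integration.integrable_mult_right
          Bochner_Integration.integrable_sum s xs)
        fix t
        have "norm (s t) \<le> (\<Sum>j\<in>A. norm (c x j) * norm (xs j t))"
          unfolding s_eq by (rule order_trans[OF norm_sum]) (simp add: norm_mult)
        then have "norm (s t) powr p \<le> (\<Sum>j\<in>A. norm (c x j) * norm (xs j t)) powr p"
          using p by (intro powr_mono2) auto
        also have "\<dots> \<le> (\<Sum>j\<in>A. norm (c x j) powr p) * (\<Sum>j\<in>A. norm (xs j t) powr p)"
          using p \<open>p \<le> 2\<close> by (intro sum_mult_powr_le) auto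
        also have "\<dots> \<le> B * measure lebesgue E * (\<Sum>j\<in>A. norm (xs j t) powr p)"
          using B(2)[OF x A] by (intro mult_right_mono sum_nonneg) (auto simp: powr_norm_x)
        finally show "indicator E t * norm (s t) powr p
            \<le> B * measure lebesgue E * (\<Sum>j\<in>A. indicator E t * norm (xs j t) powr p)"
          by (simp add: indicator_def)
      qed auto
      also have "\<dots> = B * measure lebesgue E * (\<Sum>j\<in>A. Lp_mass p E (xs j))"
        unfolding Lp_mass_def by (subst Bochner_Integration.integral_sum[symmetric])
          (auto intro!: Lp_integrable_on xs)
      finally have "(1/2) powr p \<le> B * (\<Sum>j\<in>A. Lp_mass p E (xs j))"
        using E by (simp add: field_simps)
      then show ?case
        using B(1) by (simp add: \<beta>_def A_def field_simps)
    qed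
  qed
qed

lemma no_translate_expansion:
  assumes "p \<le> 2"
  shows False
proof -
  obtain \<beta> where \<beta>: "0 < \<beta>"
    "\<And>E. E \<in> lmeasurable \<Longrightarrow> 0 < measure lebesgue E \<Longrightarrow>
       \<forall>\<^sub>F M in sequentially. \<beta> \<le> (\<Sum>j\<in>{..<M} \<inter> J. Lp_mass p E (xs j))"
    using mass_on_every_set[OF assms] by blast
  obtain r L where r: "0 < r"
    and L: "\<And>A. finite A \<Longrightarrow> A \<subseteq> J \<Longrightarrow> (\<Sum>j\<in>A. Lp_mass p (ball 0 r) (xs j)) \<le> L"
    using local_mass_bounded by blast
  obtain H :: nat where H: "L < real H * \<beta>"
    using reals_Archimedean3[OF \<beta>(1)] by blast
  show False
  proof (rule many_disjoint_balls[OF r, of H])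
    fix E :: "nat \<Rightarrow> 'v set"
    assume E: "disjoint_family_on E {..<H}"
      "\<And>i. i < H \<Longrightarrow> E i \<subseteq> ball 0 r" "\<And>i. E i \<in> lmeasurable" "\<And>i. 0 < measure lebesgue (E i)"
    have "\<forall>\<^sub>F M in sequentially. \<forall>i\<in>{..<H}. \<beta> \<le> (\<Sum>j\<in>{..<M} \<inter> J. Lp_mass p (E i) (xs j))"
      using \<beta>(2) E(3,4) by (intro eventually_ball_finite) auto
    then obtain M where M: "\<And>i. i < H \<Longrightarrow> \<beta> \<le> (\<Sum>j\<in>{..<M} \<inter> J. Lp_mass p (E i) (xs j))"
      by (auto simp: eventually_sequentially)
    define A where "A = {..<M} \<inter> J"
    have "real H * \<beta> = (\<Sum>i<H. \<beta>)"
      by simp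
    also have "\<dots> \<le> (\<Sum>i<H. \<Sum>j\<in>A. Lp_mass p (E i) (xs j))"
      unfolding A_def using M by (intro sum_mono) auto
    also have "\<dots> = (\<Sum>j\<in>A. \<Sum>i<H. Lp_mass p (E i) (xs j))"
      by (rule sum.swap)
    also have "\<dots> \<le> (\<Sum>j\<in>A. Lp_mass p (ball 0 r) (xs j))"
      using E by (intro sum_mono sum_Lp_mass_disjoint xs) (auto simp: fmeasurableD)
    also have "\<dots> \<le> L"
      by (rule L) (auto simp: A_def)
    finally show False
      using H by simp
  qed
qed

end

section \<open>Finite and infinite families\<close>

lemma unconditional_basis_seq_expansion:
  assumes p: "1 \<le> p" and basis: "unconditional_basis_seq p xs"
  obtains c where "Lp_unconditional_expansion p UNIV xs c"
proof -
  have "\<forall>x\<in>Lp p. \<exists>a. Lp_sums p xs a x \<and> (\<forall>b. Lp_sums p xs b x \<longrightarrow> b = a) \<and>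
        (\<forall>\<pi>. bij \<pi> \<longrightarrow> Lp_sums p (xs \<circ> \<pi>) (a \<circ> \<pi>) x)"
    using basis by (simp add: unconditional_basis_seq_def)
  then obtain c where c: "\<forall>x\<in>Lp p. Lp_sums p xs (c x) x \<and> (\<forall>b. Lp_sums p xs b x \<longrightarrow> b = c x) \<and>
        (\<forall>\<pi>. bij \<pi> \<longrightarrow> Lp_sums p (xs \<circ> \<pi>) (c x \<circ> \<pi>) x)"
    by (rule bchoice[THEN exE])
  have "Lp_unconditional_expansion p UNIV xs c"
    using p basis c by unfold_locales (auto simp: unconditional_basis_seq_def)
  then show thesis by (rule that)
qed

lemma finite_basis_expansion:
  fixes F :: "'j \<Rightarrow> 'v::euclidean_space \<Rightarrow> 'k::{real_normed_field, euclidean_space}"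
  assumes p: "1 \<le> p" and J: "finite J" and basis: "unconditional_basis p J F"
    and e: "bij_betw e {..<N} J"
  obtains c where "Lp_unconditional_expansion p {..<N} (\<lambda>m. if m < N then F (e m) else (\<lambda>t. 0)) c"
proof -
  define xs where "xs m = (if m < N then F (e m) else (\<lambda>t. 0))" for m
  have F: "F j \<in> Lp p" if "j \<in> J" for j
    using basis J that by (simp add: unconditional_basis_def)
  have eJ: "e m \<in> J" if "m < N" for m
    using e that by (auto dest: bij_betwE)
  have xs: "xs m \<in> Lp p" for m
    using F eJ by (simp add: xs_def)
  have "\<forall>x\<in>Lp p. \<exists>a. (AE t in lebesgue. x t = (\<Sum>j\<in>J. a j * F j t)) \<and>
           (\<forall>b. (AE t in lebesgue. x t = (\<Sum>j\<in>J. b j * F j t)) \<longrightarrow> (\<forall>j\<in>J. b j = a j))"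
    using basis J by (simp add: unconditional_basis_def)
  then obtain a where a: "\<forall>x\<in>Lp p. (AE t in lebesgue. x t = (\<Sum>j\<in>J. a x j * F j t)) \<and>
           (\<forall>b. (AE t in lebesgue. x t = (\<Sum>j\<in>J. b j * F j t)) \<longrightarrow> (\<forall>j\<in>J. b j = a x j))"
    by (rule bchoice[THEN exE])
  define c where "c x m = (if m < N then a x (e m) else 0)" for x m
  have sum_J: "(\<Sum>j\<in>J. b j * F j t) = (\<Sum>m<N. b (e m) * xs m t)" for b t
    by (subst sum.reindex_bij_betw[OF e, symmetric]) (simp add: xs_def)
  have norm_zero: "Lp_norm p (\<lambda>t. x t - (\<Sum>j\<in>J. b j * F j t)) = 0
      \<longleftrightarrow> (AE t in lebesgue. x t = (\<Sum>j\<in>J. b j * F j t))" if "x \<in> Lp p" for x b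
    by (subst Lp_norm_eq_0_iff) (auto intro!: p Lp_diff Lp_sum Lp_cmult that F)
  have "Lp_unconditional_expansion p {..<N} xs c"
  proof
    fix x :: "'v \<Rightarrow> 'k" and \<pi> :: "nat \<Rightarrow> nat" assume x: "x \<in> Lp p" and \<pi>: "bij \<pi>"
    \<comment> \<open>from \<open>M0\<close> on, the rearranged partial sums contain all \<open>N\<close> nonzero terms\<close>
    define M0 where "M0 = Suc (Max (insert 0 (inv \<pi> ` {..<N})))"
    have cover: "(\<Sum>m<M. c x (\<pi> m) * xs (\<pi> m) t) = (\<Sum>j\<in>J. a x j * F j t)" if "M0 \<le> M" for M t
    proof -
      have "{..<N} \<subseteq> \<pi> ` {..<M}"
      proof
        fix m assume m: "m \<in> {..<N}"
        then have "inv \<pi> m \<le> Max (insert 0 (inv \<pi> ` {..<N}))"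
          by (intro Max_ge) auto
        then have "inv \<pi> m < M"
          using that by (simp add: M0_def)
        moreover have "m = \<pi> (inv \<pi> m)"
          using \<pi> by (simp add: bij_is_surj surj_f_inv_f)
        ultimately show "m \<in> \<pi> ` {..<M}"
          by blast
      qed
      then have "(\<Sum>m\<in>\<pi> ` {..<M}. c x m * xs m t) = (\<Sum>m<N. c x m * xs m t)"
        by (intro sum.mono_neutral_right) (auto simp: c_def)
      moreover have "(\<Sum>m\<in>\<pi> ` {..<M}. c x m * xs m t) = (\<Sum>m<M. c x (\<pi> m) * xs (\<pi> m) t)"
        using \<pi> by (subst sum.reindex) (auto simp: bij_def intro: inj_on_subset)
      ultimately show ?thesis
        by (simp add: sum_J c_def)
    qed
    have "Lp_norm p (\<lambda>t. x t - (\<Sum>j\<in>J. a x j * F j t)) = 0"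
      using a x norm_zero by blast
    then show "Lp_sums p (xs \<circ> \<pi>) (c x \<circ> \<pi>) x"
      unfolding Lp_sums_def
      by (intro tendsto_eventually eventually_mono[OF eventually_ge_at_top[of M0]]) (simp add: cover)
  next
    fix x :: "'v \<Rightarrow> 'k" and b
    assume x: "x \<in> Lp p" and b: "Lp_sums p xs b x" "\<And>m. m \<notin> {..<N} \<Longrightarrow> b m = 0"
    define b' where "b' j = b (inv_into {..<N} e j)" for j
    have b': "b' (e m) = b m" if "m < N" for m
      using e that by (simp add: b'_def bij_betw_def inv_into_f_f)
    have "(\<Sum>m<M. b m * xs m t) = (\<Sum>j\<in>J. b' j * F j t)" if "N \<le> M" for M t
    proof -
      have "(\<Sum>m<M. b m * xs m t) = (\<Sum>m<N. b m * xs m t)"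
        using that b(2) by (intro sum.mono_neutral_right) auto
      then show ?thesis
        by (simp add: sum_J b')
    qed
    then have "(\<lambda>M. Lp_norm p (\<lambda>t. x t - (\<Sum>m<M. b m * xs m t)))
        \<longlonglongrightarrow> Lp_norm p (\<lambda>t. x t - (\<Sum>j\<in>J. b' j * F j t))"
      by (intro tendsto_eventually eventually_mono[OF eventually_ge_at_top[of N]]) simp
    then have "Lp_norm p (\<lambda>t. x t - (\<Sum>j\<in>J. b' j * F j t)) = 0"
      using b(1) LIMSEQ_unique unfolding Lp_sums_def by blast
    then have "\<forall>j\<in>J. b' j = a x j"
      using a x norm_zero by blast
    then have "b m = c x m" for m
      using b' eJ b(2) by (cases "m < N") (auto simp: c_def)
    then show "b = c x" by blast
  qed (simp_all add: p xs c_def)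
  then show thesis
    using that unfolding xs_def by blast
qed

theorem theorem4p3:
  fixes p :: real and n :: nat
    and f :: "nat \<Rightarrow> real ^ 'd \<Rightarrow> 'k::{real_normed_field, euclidean_space}"
    and I :: "nat \<Rightarrow> 'i set"
    and \<gamma> :: "nat \<Rightarrow> 'i \<Rightarrow> real ^ 'd"
  assumes "1 < p" and "p \<le> 2" and "1 \<le> n"
    and "\<And>k. k \<in> {1..n} \<Longrightarrow> f k \<in> Lp p"
    and "\<And>k. k \<in> {1..n} \<Longrightarrow> \<not> (AE t in lebesgue. f k t = 0)"
    and "\<And>k. k \<in> {1..n} \<Longrightarrow> countable (I k)"
  shows "\<not> unconditional_basis p (SIGMA k:{1..n}. I k) (\<lambda>(k, i). translate (\<gamma> k i) (f k))"
proof
  define \<Sigma> where "\<Sigma> = (SIGMA k:{1..n}. I k)"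
  define F where "F = (\<lambda>(k, i). translate (\<gamma> k i) (f k))"
  assume "unconditional_basis p (SIGMA k:{1..n}. I k) (\<lambda>(k, i). translate (\<gamma> k i) (f k))"
  then have basis: "unconditional_basis p \<Sigma> F"
    by (simp add: \<Sigma>_def F_def)
  have p: "1 \<le> p" using assms by simp
  have False if "Lp_unconditional_expansion p J xs c"
    and xs: "\<And>m. m \<in> J \<Longrightarrow> e m \<in> \<Sigma> \<and> xs m = F (e m)" for J xs c e
  proof -
    have xs': "fst (e m) \<in> {1..n} \<and> xs m = translate (case e m of (k, i) \<Rightarrow> \<gamma> k i) (f (fst (e m)))"
      if "m \<in> J" for m
      using xs[OF that] by (auto simp: \<Sigma>_def F_def split: prod.splits)
    interpret Lp_unconditional_expansion p J xs c by fact
    interpret Lp_translate_expansion p J xs c "{1..n}" f "\<lambda>m. fst (e m)" "\<lambda>m. case e m of (k, i) \<Rightarrow> \<gamma> k i"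
      using assms(4,5) xs' by unfold_locales simp_all
    show False
      by (rule no_translate_expansion[OF \<open>p \<le> 2\<close>])
  qed
  note no_expansion = this
  show False
  proof (cases "finite \<Sigma>")
    case True
    then obtain e where "bij_betw e {0..<card \<Sigma>} \<Sigma>"
      using ex_bij_betw_nat_finite by blast
    then have e: "bij_betw e {..<card \<Sigma>} \<Sigma>"
      by (simp add: lessThan_atLeast0)
    obtain c where "Lp_unconditional_expansion p {..<card \<Sigma>} (\<lambda>m. if m < card \<Sigma> then F (e m) else (\<lambda>t. 0)) c"
      by (rule finite_basis_expansion[OF p True basis e])
    then show False
      by (rule no_expansion[of _ _ _ e]) (use bij_betwE[OF e] in auto)
  next
    case False
    then obtain e :: "nat \<Rightarrow> nat \<times> 'i" where e: "bij_betw e UNIV \<Sigma>" "unconditional_basis_seq p (F \<circ> e)"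
      using basis by (auto simp: unconditional_basis_def)
    obtain c where "Lp_unconditional_expansion p UNIV (F \<circ> e) c"
      by (rule unconditional_basis_seq_expansion[OF p e(2)])
    then show False
      by (rule no_expansion[of _ _ _ e]) (use bij_betwE[OF e(1)] in auto)
  qed
qed

end
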